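(* Consider a manifold $\mathcal{M}$ equipped with a retraction $\mathrm{R}$ and a twice differentiable function $F:\mathcal{M}\to\mathbb{R}$ that admits a strong local minimizer $x^\star$, that is, a point such that the Riemannian Hessian $\mathrm{Hess}\,F(x^\star)$ is positive definite. Let $x\in\mathcal{M}$ and $\eta\in T_x\mathcal{M}$. If $x$ is close to $x^\star$, $\eta$ brings a superlinear improvement towards $x^\star$, that is $$\mathrm{dist}_{\mathcal{M}}(\mathrm{R}_x(\eta),x^\star)=o(\mathrm{dist}_{\mathcal{M}}(x,x^\star))\quad\text{as }x\to x^\star,$$ and $0<m_1<1/2$, then $\eta$ is acceptable by the Armijo rule with unit stepsize $\alpha=1$, that is, $$F(\mathrm{R}_x(\eta))\le F(x)+m_1\langle\mathrm{grad}\,F(x),\eta\rangle.$$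
   Context: $\mathcal{M}$ is a submanifold of $\mathbb{R}^n$ (or of $\mathbb{R}^{m\times n}$), whose tangent spaces $T_x\mathcal{M}$ carry the scalar product $\langle\cdot,\cdot\rangle$ induced by the ambient space. $\mathrm{grad}\,F$ and $\mathrm{Hess}\,F$ denote the Riemannian gradient and Riemannian Hessian of $F$ on $\mathcal{M}$, and $\mathrm{dist}_{\mathcal{M}}(x,y)$ is the Riemannian distance, i.e. the infimum of the lengths of smooth curves on $\mathcal{M}$ joining $x$ and $y$. A retraction is a smooth map $\mathrm{R}$ from the tangent bundle of $\mathcal{M}$ to $\mathcal{M}$ such that, writing $\mathrm{R}_x=\mathrm{R}(x,\cdot):T_x\mathcal{M}\to\mathcal{M}$, one has $\mathrm{R}_x(0)=x$ and the differential $\mathrm{D}\mathrm{R}_x(0):T_x\mathcal{M}\to T_x\mathcal{M}$ is the identity. For a point $x\in\mathcal{M}$ and a direction $\eta\in T_x\mathcal{M}$, a stepsize $\alpha>0$ is acceptable by the Armijo rule with parameter $m_1$ if $F(\mathrm{R}_x(\alpha\eta))\le F(x)+m_1\alpha\langle\mathrm{grad}\,F(x),\eta\rangle$.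
   Formalization: The formal theorem also requires |η| < ρ near x*, for some ρ > 0 independent of x and η; without it the claim fails (circle, exponential map, η winding once around); x* is also required to be a local minimizer of F, as its name says. *)

theory Defs
  imports "HOL-Analysis.Analysis" "HOL-Library.Landau_Symbols"
begin

text \<open>The ambient space is an arbitrary Euclidean space, so that vectors and matrices
  are both covered.\<close>

text \<open>\<open>Ck_on k U f\<close> is only meant for open \<open>U\<close>. In finite dimension, \<open>f\<close> is \<open>C\<^sup>k\<^sup>+\<^sup>1\<close> iff it is
  differentiable and each of its directional derivatives is \<open>C\<^sup>k\<close>.\<close>

primrec Ck_on :: "nat \<Rightarrow> 'a::euclidean_space set \<Rightarrow> ('a \<Rightarrow> 'b::real_normed_vector) \<Rightarrow> bool" where
  "Ck_on 0 U f \<longleftrightarrow> continuous_on U f"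
| "Ck_on (Suc k) U f \<longleftrightarrow> (\<forall>x\<in>U. f differentiable (at x)) \<and>
     (\<forall>v. Ck_on k U (\<lambda>x. frechet_derivative f (at x) v))"

text \<open>Smoothness on an arbitrary set means that there are local smooth extensions to open
  sets; on an open set this is ordinary smoothness. Values outside \<open>A\<close> are irrelevant.\<close>

definition smooth_on :: "'a::euclidean_space set \<Rightarrow> ('a \<Rightarrow> 'b::real_normed_vector) \<Rightarrow> bool" where
  "smooth_on A f \<longleftrightarrow> (\<forall>p\<in>A. \<exists>U g. open U \<and> p \<in> U \<and> (\<forall>k. Ck_on k U g) \<and>
     (\<forall>y\<in>U \<inter> A. g y = f y))"

text \<open>Embedded smooth \<open>d\<close>-dimensional submanifolds, by means of slice charts.\<close>

definition submanifold :: "nat \<Rightarrow> 'a::euclidean_space set \<Rightarrow> bool" where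
  "submanifold d M \<longleftrightarrow> (\<forall>x\<in>M. \<exists>U V \<phi> \<psi> S.
     open U \<and> x \<in> U \<and> open (V :: 'a set) \<and> homeomorphism U V \<phi> \<psi> \<and>
     smooth_on U \<phi> \<and> smooth_on V \<psi> \<and>
     subspace S \<and> dim S = d \<and> \<phi> ` (U \<inter> M) = V \<inter> S)"

definition curve_through :: "'a::euclidean_space set \<Rightarrow> 'a \<Rightarrow> (real \<Rightarrow> 'a) \<Rightarrow> bool" where
  "curve_through M x \<gamma> \<longleftrightarrow>
     (\<exists>e>0. smooth_on {-e<..<e} \<gamma> \<and> \<gamma> ` {-e<..<e} \<subseteq> M) \<and> \<gamma> 0 = x"

definition tangent_space :: "'a::euclidean_space set \<Rightarrow> 'a \<Rightarrow> 'a set" where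
  "tangent_space M x = {vector_derivative \<gamma> (at 0) | \<gamma>. curve_through M x \<gamma>}"

definition tangent_bundle :: "'a::euclidean_space set \<Rightarrow> ('a \<times> 'a) set" where
  "tangent_bundle M = {(x, v). x \<in> M \<and> v \<in> tangent_space M x}"

text \<open>The infimum is taken over a nonempty set precisely when \<open>x\<close> and \<open>y\<close> lie in the same
  connected component of \<open>M\<close>; otherwise the value is unspecified.\<close>

definition riem_dist :: "'a::euclidean_space set \<Rightarrow> 'a \<Rightarrow> 'a \<Rightarrow> real" where
  "riem_dist M x y =
     Inf {integral {0..1} (\<lambda>t. norm (vector_derivative \<gamma> (at t within {0..1}))) | \<gamma>.
            smooth_on {0..1} \<gamma> \<and> \<gamma> ` {0..1} \<subseteq> M \<and> \<gamma> 0 = x \<and> \<gamma> 1 = y}"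

text \<open>Twice (Frechet) differentiable, not necessarily \<open>C\<^sup>2\<close>: locally \<open>F\<close> extends to a
  differentiable function \<open>G\<close> whose Euclidean gradient \<open>g\<close> is differentiable.\<close>

definition twice_differentiable_on_manifold :: "'a::euclidean_space set \<Rightarrow> ('a \<Rightarrow> real) \<Rightarrow> bool" where
  "twice_differentiable_on_manifold M F \<longleftrightarrow> (\<forall>x\<in>M. \<exists>U G g. open U \<and> x \<in> U \<and>
     (\<forall>y\<in>U. (G has_derivative (\<lambda>h. g y \<bullet> h)) (at y) \<and> g differentiable (at y)) \<and>
     (\<forall>y\<in>U \<inter> M. G y = F y))"

text \<open>The tangent vector representing the differential of \<open>F\<close> at \<open>x\<close>.\<close>

definition rgrad :: "'a::euclidean_space set \<Rightarrow> ('a \<Rightarrow> real) \<Rightarrow> 'a \<Rightarrow> 'a" where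
  "rgrad M F x = (THE g. g \<in> tangent_space M x \<and>
     (\<forall>\<gamma>. curve_through M x \<gamma> \<longrightarrow>
        ((\<lambda>t. F (\<gamma> t)) has_real_derivative g \<bullet> vector_derivative \<gamma> (at 0)) (at 0)))"

text \<open>The Hessian is the covariant derivative of the gradient field. For the induced metric the
  Levi-Civita derivative along \<open>\<gamma>\<close> is the orthogonal projection onto the tangent space of the
  ambient derivative \<open>D\<close>; \<open>w\<close> is that projection. Only meaningful for tangent \<open>v\<close>.\<close>

definition rhess :: "'a::euclidean_space set \<Rightarrow> ('a \<Rightarrow> real) \<Rightarrow> 'a \<Rightarrow> 'a \<Rightarrow> 'a" where
  "rhess M F x v = (THE w. w \<in> tangent_space M x \<and>
     (\<forall>\<gamma>. curve_through M x \<gamma> \<and> vector_derivative \<gamma> (at 0) = v \<longrightarrow>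
        (\<exists>D. ((\<lambda>t. rgrad M F (\<gamma> t)) has_vector_derivative D) (at 0) \<and>
             (\<forall>u\<in>tangent_space M x. orthogonal u (D - w)))))"

definition strong_local_minimizer :: "'a::euclidean_space set \<Rightarrow> ('a \<Rightarrow> real) \<Rightarrow> 'a \<Rightarrow> bool" where
  "strong_local_minimizer M F xs \<longleftrightarrow> xs \<in> M \<and>
     (\<exists>e>0. \<forall>y\<in>M \<inter> ball xs e. F xs \<le> F y) \<and>
     (\<forall>v\<in>tangent_space M xs. v \<noteq> 0 \<longrightarrow> rhess M F xs v \<bullet> v > 0)"

text \<open>Not to be confused with the topological retractions of the library.\<close>

definition manifold_retraction :: "'a::euclidean_space set \<Rightarrow> ('a \<Rightarrow> 'a \<Rightarrow> 'a) \<Rightarrow> bool" where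
  "manifold_retraction M R \<longleftrightarrow>
     smooth_on (tangent_bundle M) (\<lambda>(x, v). R x v) \<and>
     (\<forall>x\<in>M. (\<forall>v\<in>tangent_space M x. R x v \<in> M) \<and> R x 0 = x \<and>
        (R x has_derivative (\<lambda>v. v)) (at 0 within tangent_space M x))"

definition armijo_acceptable ::
  "'a::euclidean_space set \<Rightarrow> ('a \<Rightarrow> 'a \<Rightarrow> 'a) \<Rightarrow> ('a \<Rightarrow> real) \<Rightarrow> real \<Rightarrow> 'a \<Rightarrow> 'a \<Rightarrow> real \<Rightarrow> bool" where
  "armijo_acceptable M R F m1 x \<eta> \<alpha> \<longleftrightarrow>
     F (R x (\<alpha> *\<^sub>R \<eta>)) \<le> F x + m1 * \<alpha> * (rgrad M F x \<bullet> \<eta>)"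

end

theory Submission
  imports Defs
begin

text \<open>In a slice chart, \<open>rgrad M F\<close> is differentiable at the minimizer \<open>x\<^sub>*\<close>, where it vanishes; let \<open>H\<close> be
  its derivative, so that \<open>H v \<bullet> v\<close> is the Riemannian Hessian form on the tangent space. With
  \<open>u = x - x\<^sub>*\<close> one gets \<open>rgrad M F x = H u + o(u)\<close> and, integrating along a line in the chart,
  \<open>F x - F x\<^sub>* = H u \<bullet> u / 2 + o(\<bar>u\<bar>\<^sup>2)\<close>. Near \<open>x\<^sub>*\<close> the Riemannian distance is equivalent to the
  Euclidean one, so the superlinear improvement forces \<open>R x \<eta> = x\<^sub>* + o(u)\<close>; as \<open>R x \<eta> = x + \<eta> + o(\<eta>)\<close>
  uniformly in \<open>x\<close>, this gives \<open>\<eta> = -u + o(u)\<close>. Hence the Armijo gap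
  \<open>F x + m rgrad M F x \<bullet> \<eta> - F (R x \<eta>)\<close> equals \<open>(1/2 - m) H u \<bullet> u + o(\<bar>u\<bar>\<^sup>2)\<close>, and \<open>H\<close> is coercive
  on the tangent space.\<close>

subsection \<open>Smooth functions\<close>

text \<open>The bound 1/2 on \<open>m1\<close> comes from comparing two quantities of the same
  order: the decrease of \<open>F\<close> is about half of \<open>H u \<bullet> u\<close>, while the
  slope \<open>rgrad M F x \<bullet> \<eta>\<close> is about \<open>- H u \<bullet> u\<close>. Three
  obstacles shape the proof. \<open>F\<close> need not have continuous second derivatives, so its
  expansion rests on the derivative of the gradient at the minimizer alone, through the mean value
  theorem. The gradient involves the orthogonal projection onto a moving tangent space, whose
  differentiability the chart does not show; it is therefore recovered from a linear equation with
  visibly differentiable coefficients. The retraction is normalised fibre by fibre, so uniformity in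
  the base point has to be extracted from its joint smoothness.\<close>

lemma Ck_on_subset: "Ck_on k U f \<Longrightarrow> W \<subseteq> U \<Longrightarrow> Ck_on k W f"
  by (induction k arbitrary: f) (auto intro: continuous_on_subset)

text \<open>\<open>frechet_derivative\<close> chooses from the predicate
  \<open>has_derivative\<close>, which sees only values near the point; so the chosen derivatives
  agree even where neither function is differentiable.\<close>

lemma frechet_derivative_cong_open:
  assumes "open U" "x \<in> U" "\<And>y. y \<in> U \<Longrightarrow> f y = g y"
  shows "frechet_derivative f (at x) = frechet_derivative g (at x)"
proof -
  have "(f has_derivative D) (at x) \<longleftrightarrow> (g has_derivative D) (at x)" for D
    using assms has_derivative_transform_within_open[of f D x UNIV U g]
      has_derivative_transform_within_open[of g D x UNIV U f] by auto
  then show ?thesis by (simp add: frechet_derivative_def)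
qed

lemma Ck_on_cong:
  assumes "open U" "\<And>y. y \<in> U \<Longrightarrow> f y = g y" "Ck_on k U f"
  shows "Ck_on k U g"
  using assms(2,3)
proof (induction k arbitrary: f g)
  case 0
  then show ?case by (auto cong: continuous_on_cong)
next
  case (Suc k)
  have "g differentiable (at x)" if "x \<in> U" for x
  proof -
    have "f differentiable (at x)" using Suc.prems(2) that by simp
    then obtain D where "(f has_derivative D) (at x)" by (auto simp: differentiable_def)
    then have "(g has_derivative D) (at x)"
      using has_derivative_transform_within_open[of f D x UNIV U g] assms(1) that Suc.prems(1) by auto
    then show ?thesis by (auto simp: differentiable_def)
  qed
  moreover have "Ck_on k U (\<lambda>x. frechet_derivative g (at x) v)" for v
  proof (rule Suc.IH)
    show "frechet_derivative f (at y) v = frechet_derivative g (at y) v" if "y \<in> U" for y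
      using frechet_derivative_cong_open[OF assms(1) that, of f g] Suc.prems(1) by metis
    show "Ck_on k U (\<lambda>x. frechet_derivative f (at x) v)" using Suc.prems(2) by simp
  qed
  ultimately show ?case by simp
qed

text \<open>\<open>smooth_on\<close> provides a separate extension around each point; this glues the
  local statements.\<close>

lemma Ck_on_local:
  assumes "\<And>p. p \<in> U \<Longrightarrow> \<exists>W. open W \<and> p \<in> W \<and> Ck_on k W f"
  shows "Ck_on k U f"
  using assms
proof (induction k arbitrary: f)
  case 0
  then have "isCont f p" if "p \<in> U" for p
    using that by (metis Ck_on.simps(1) continuous_on_eq_continuous_at)
  then show ?case by (simp add: continuous_at_imp_continuous_on)
next
  case (Suc k)
  have "f differentiable (at p)" if "p \<in> U" for p
    using Suc.prems[OF that] by auto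
  moreover have "Ck_on k U (\<lambda>x. frechet_derivative f (at x) v)" for v
    by (rule Suc.IH) (use Suc.prems in fastforce)
  ultimately show ?case by simp
qed

text \<open>On an open set each extension agrees with \<open>f\<close> on a whole neighbourhood, so
  its derivatives are those of \<open>f\<close>.\<close>

lemma smooth_on_open:
  assumes "open U" "smooth_on U f"
  shows "Ck_on k U f"
proof (rule Ck_on_local)
  fix p assume "p \<in> U"
  then obtain W g where W: "open W" "p \<in> W" "Ck_on k W g" "\<And>y. y \<in> W \<inter> U \<Longrightarrow> g y = f y"
    using assms(2) unfolding smooth_on_def by meson
  have "Ck_on k (W \<inter> U) f"
    by (rule Ck_on_cong[of _ g]) (use W assms(1) Ck_on_subset[OF W(3), of "W \<inter> U"] in auto)
  then show "\<exists>W. open W \<and> p \<in> W \<and> Ck_on k W f"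
    using W assms(1) \<open>p \<in> U\<close> by (intro exI[of _ "W \<inter> U"]) auto
qed

text \<open>Chart lines are the only curves that the proof constructs, so this replaces a chain rule
  of order \<open>k\<close>: the derivative of the composite is a directional derivative of
  \<open>f\<close> along a multiple of \<open>b\<close>, composed with the same line.\<close>

lemma Ck_on_affine:
  fixes f :: "'a::euclidean_space \<Rightarrow> 'b::real_normed_vector" and a b :: 'a
  assumes "open U" "Ck_on k U f"
  shows "Ck_on k {t::real. a + t *\<^sub>R b \<in> U} (\<lambda>t. f (a + t *\<^sub>R b))"
  using assms(2)
proof (induction k arbitrary: f)
  case 0
  then show ?case
    by (auto intro!: continuous_on_compose2[of U f] continuous_intros)
next
  case (Suc k)
  have D: "((\<lambda>t. f (a + t *\<^sub>R b)) has_derivative (\<lambda>r. frechet_derivative f (at (a + t *\<^sub>R b)) (r *\<^sub>R b))) (at t)"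
    if "a + t *\<^sub>R b \<in> U" for t :: real
    by (rule has_derivative_compose[where g = f and f = "\<lambda>t. a + t *\<^sub>R b"])
       (use that Suc.prems frechet_derivative_works in \<open>auto intro!: derivative_eq_intros\<close>)
  let ?A = "{t::real. a + t *\<^sub>R b \<in> U}"
  have "Ck_on k ?A (\<lambda>t. frechet_derivative (\<lambda>t. f (a + t *\<^sub>R b)) (at t) r)" for r
  proof -
    have eq: "frechet_derivative (\<lambda>t. f (a + t *\<^sub>R b)) (at t) r = frechet_derivative f (at (a + t *\<^sub>R b)) (r *\<^sub>R b)"
      if "t \<in> ?A" for t
      using frechet_derivative_at[OF D] that by (metis mem_Collect_eq)
    have *: "Ck_on k ?A (\<lambda>t. frechet_derivative f (at (a + t *\<^sub>R b)) (r *\<^sub>R b))"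
      using Suc.IH[of "\<lambda>x. frechet_derivative f (at x) (r *\<^sub>R b)"] Suc.prems by simp
    have "open ?A"
      using continuous_open_vimage[of U "\<lambda>t. a + t *\<^sub>R b"] assms(1)
      by (simp add: vimage_def)
    then show ?thesis using Ck_on_cong[OF _ _ *] eq by metis
  qed
  then show ?case using D by (auto simp: differentiable_def)
qed

lemma smooth_on_affine:
  fixes f :: "'a::euclidean_space \<Rightarrow> 'b::real_normed_vector" and a b :: 'a and T :: "real set"
  assumes "smooth_on A f" "\<And>t. t \<in> T \<Longrightarrow> a + t *\<^sub>R b \<in> A"
  shows "smooth_on T (\<lambda>t. f (a + t *\<^sub>R b))"
  unfolding smooth_on_def
proof
  fix p assume "p \<in> T"
  then obtain U g where U: "open U" "a + p *\<^sub>R b \<in> U" "\<And>k. Ck_on k U g" "\<And>y. y \<in> U \<inter> A \<Longrightarrow> g y = f y"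
    using assms unfolding smooth_on_def by meson
  have "open {t. a + t *\<^sub>R b \<in> U}"
    using continuous_open_vimage[of U "\<lambda>t. a + t *\<^sub>R b"] U(1) by (simp add: vimage_def)
  then show "\<exists>V h. open V \<and> p \<in> V \<and> (\<forall>k. Ck_on k V h) \<and> (\<forall>y\<in>V \<inter> T. h y = f (a + y *\<^sub>R b))"
    using U assms(2) Ck_on_affine[OF U(1,3)]
    by (intro exI[of _ "{t. a + t *\<^sub>R b \<in> U}"] exI[of _ "\<lambda>t. g (a + t *\<^sub>R b)"]) auto
qed

lemma Ck_on_has_derivative:
  "Ck_on (Suc k) U f \<Longrightarrow> x \<in> U \<Longrightarrow> (f has_derivative frechet_derivative f (at x)) (at x)"
  by (simp add: frechet_derivative_works[symmetric])

text \<open>\<open>Ck_on\<close> gives continuity of the derivative in one direction at a time.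
  Control on the finitely many basis vectors, each to within \<open>e\<close> divided by the
  dimension, bounds the operator norm.\<close>

lemma C1_derivative_continuous:
  assumes "open U" "Ck_on (Suc 0) U f" "p \<in> U" "e > 0"
  obtains r where "r > 0" "ball p r \<subseteq> U"
    "\<And>x v. x \<in> ball p r \<Longrightarrow>
      norm (frechet_derivative f (at x) v - frechet_derivative f (at p) v) \<le> e * norm v"
proof -
  define n where "n = real (card (Basis :: 'a set))"
  have "n > 0" by (simp add: n_def card_gt_0_iff)
  have "\<forall>i\<in>Basis. \<forall>\<^sub>F x in at p. dist (frechet_derivative f (at x) i) (frechet_derivative f (at p) i) < e / n"
  proof
    fix i :: 'a
    have "isCont (\<lambda>x. frechet_derivative f (at x) i) p"
      using assms continuous_on_eq_continuous_at by (metis Ck_on.simps)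
    then show "\<forall>\<^sub>F x in at p. dist (frechet_derivative f (at x) i) (frechet_derivative f (at p) i) < e / n"
      using \<open>n > 0\<close> \<open>e > 0\<close> by (auto simp: isCont_def tendsto_iff)
  qed
  then have "\<forall>\<^sub>F x in at p. \<forall>i\<in>Basis. dist (frechet_derivative f (at x) i) (frechet_derivative f (at p) i) < e / n"
    by (simp add: eventually_ball_finite_distrib)
  moreover have "\<forall>\<^sub>F x in at p. x \<in> U"
    using assms by (simp add: eventually_at_in_open')
  ultimately have "\<forall>\<^sub>F x in at p. x \<in> U \<and> (\<forall>i\<in>Basis. dist (frechet_derivative f (at x) i) (frechet_derivative f (at p) i) < e / n)"
    by eventually_elim auto
  then obtain r where r: "r > 0" "\<And>x. x \<noteq> p \<Longrightarrow> dist x p < r \<Longrightarrow> x \<in> U \<and>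
      (\<forall>i\<in>Basis. dist (frechet_derivative f (at x) i) (frechet_derivative f (at p) i) < e / n)"
    unfolding eventually_at by auto
  have U: "x \<in> U" if "x \<in> ball p r" for x
    using r(2)[of x] that assms(3) by (cases "x = p") (auto simp: dist_commute)
  show ?thesis
  proof
    show "r > 0" by fact
    show "ball p r \<subseteq> U" using U by blast
    fix x v assume x: "x \<in> ball p r"
    define L where "L = (\<lambda>v. frechet_derivative f (at x) v - frechet_derivative f (at p) v)"
    have "linear L"
      unfolding L_def using Ck_on_has_derivative[OF assms(2)] U[OF x] assms(3)
      by (intro linear_compose_sub has_derivative_linear) auto
    have "L v = L (\<Sum>i\<in>Basis. (v \<bullet> i) *\<^sub>R i)" by (simp add: euclidean_representation)
    also have "\<dots> = (\<Sum>i\<in>Basis. (v \<bullet> i) *\<^sub>R L i)"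
      using \<open>linear L\<close> by (simp add: linear_sum linear_cmul)
    also have "norm \<dots> \<le> (\<Sum>i\<in>(Basis::'a set). norm v * (e / n))"
    proof (rule sum_norm_le)
      fix i :: 'a assume i: "i \<in> Basis"
      have "norm (L i) \<le> e / n"
        using r(2)[of x] i x \<open>n > 0\<close> \<open>e > 0\<close>
        by (cases "x = p") (auto simp: L_def dist_norm norm_minus_commute less_imp_le)
      then show "norm ((v \<bullet> i) *\<^sub>R L i) \<le> norm v * (e / n)"
        using mult_mono[OF Basis_le_norm[OF i, of v], of "norm (L i)" "e / n"] by simp
    qed
    also have "\<dots> = e * norm v" using \<open>n > 0\<close> by (simp add: n_def)
    finally show "norm (frechet_derivative f (at x) v - frechet_derivative f (at p) v) \<le> e * norm v"
      by (simp add: L_def)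
  qed
qed

text \<open>The mean value inequality for \<open>f\<close> minus its derivative at \<open>p\<close>,
  a function whose derivative has norm at most \<open>e\<close> on a small ball. Both points may
  move, which later yields uniformity in the base point.\<close>

lemma C1_strictly_differentiable:
  assumes "open U" "Ck_on (Suc 0) U f" "p \<in> U" "e > 0"
  obtains r where "r > 0" "ball p r \<subseteq> U"
    "\<And>x y. x \<in> ball p r \<Longrightarrow> y \<in> ball p r \<Longrightarrow>
      norm (f y - f x - frechet_derivative f (at p) (y - x)) \<le> e * norm (y - x)"
proof -
  obtain r where r: "r > 0" "ball p r \<subseteq> U"
    and D: "\<And>x v. x \<in> ball p r \<Longrightarrow>
      norm (frechet_derivative f (at x) v - frechet_derivative f (at p) v) \<le> e * norm v"
    using C1_derivative_continuous[OF assms] by blast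
  note lin = has_derivative_bounded_linear[OF Ck_on_has_derivative[OF assms(2,3)]]
  show ?thesis
  proof
    fix x y assume xy: "x \<in> ball p r" "y \<in> ball p r"
    have "norm ((f y - frechet_derivative f (at p) y) - (f x - frechet_derivative f (at p) x)) \<le> e * norm (y - x)"
    proof (rule differentiable_bound[where S = "ball p r" and
          f' = "\<lambda>z v. frechet_derivative f (at z) v - frechet_derivative f (at p) v"])
      fix z assume z: "z \<in> ball p r"
      show "((\<lambda>y. f y - frechet_derivative f (at p) y) has_derivative
          (\<lambda>v. frechet_derivative f (at z) v - frechet_derivative f (at p) v)) (at z within ball p r)"
        using z r(2) by (intro has_derivative_diff bounded_linear_imp_has_derivative lin
            has_derivative_at_withinI[OF Ck_on_has_derivative[OF assms(2)]]) blast
      show "onorm (\<lambda>v. frechet_derivative f (at z) v - frechet_derivative f (at p) v) \<le> e"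
        by (rule onorm_bound[OF less_imp_le[OF assms(4)] D[OF z]])
    qed (use xy in auto)
    then show "norm (f y - f x - frechet_derivative f (at p) (y - x)) \<le> e * norm (y - x)"
      by (simp add: linear_diff[OF bounded_linear.linear[OF lin], of y x] algebra_simps)
  qed (use r in auto)
qed

subsection \<open>Riemannian distance\<close>

text \<open>The derivatives within the interval, one-sided at its ends, coincide with those of a
  smooth extension and so vary continuously. Lengths are thus integrals of continuous
  functions.\<close>

lemma smooth_on_path_derivative:
  fixes \<gamma> :: "real \<Rightarrow> 'a::euclidean_space"
  assumes "smooth_on {0..1} \<gamma>"
  shows smooth_on_path_has_vector_derivative: "t \<in> {0..1} \<Longrightarrow>
      (\<gamma> has_vector_derivative vector_derivative \<gamma> (at t within {0..1})) (at t within {0..1})"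
    and smooth_on_path_continuous_derivative:
      "continuous_on {0..1} (\<lambda>t. vector_derivative \<gamma> (at t within {0..1}))"
proof -
  have *: "(\<gamma> has_vector_derivative vector_derivative \<gamma> (at t within {0..1})) (at t within {0..1})
      \<and> continuous (at t within {0..1}) (\<lambda>t. vector_derivative \<gamma> (at t within {0..1}))"
    if t: "t \<in> {0..1}" for t
  proof -
    obtain U g where U: "open U" "t \<in> U" "\<And>k. Ck_on k U g" "\<And>y. y \<in> U \<inter> {0..1} \<Longrightarrow> g y = \<gamma> y"
      using assms t unfolding smooth_on_def by meson
    have D: "(\<gamma> has_vector_derivative frechet_derivative g (at s) 1) (at s within {0..1})"
      if s: "s \<in> U" "s \<in> {0..1}" for s
    proof -
      obtain d where d: "d > 0" "ball s d \<subseteq> U" using U(1) s(1) openE by blast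
      have g: "(g has_derivative frechet_derivative g (at s)) (at s within {0..1})"
        using Ck_on_has_derivative[OF U(3) s(1)] has_derivative_at_withinI by blast
      have "(\<lambda>r. r *\<^sub>R frechet_derivative g (at s) 1) = frechet_derivative g (at s)"
      proof
        show "r *\<^sub>R frechet_derivative g (at s) 1 = frechet_derivative g (at s) r" for r
          using linear_cmul[OF has_derivative_linear[OF g], of r 1] by simp
      qed
      then have "(g has_vector_derivative frechet_derivative g (at s) 1) (at s within {0..1})"
        unfolding has_vector_derivative_def using g by presburger
      then show ?thesis
        by (rule has_vector_derivative_transform_within[OF _ d(1) s(2)])
          (use U(4) d(2) in \<open>auto simp: dist_commute subset_iff\<close>)
    qed
    have eq: "vector_derivative \<gamma> (at s within {0..1}) = frechet_derivative g (at s) 1"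
      if "s \<in> U" "s \<in> {0..1}" for s
      by (rule vector_derivative_within_closed_interval) (use D[OF that] that in auto)
    have "isCont (\<lambda>s. frechet_derivative g (at s) 1) t"
      using U(1,2) U(3)[of "Suc 0"] by (metis Ck_on.simps continuous_on_eq_continuous_at)
    then have c: "continuous (at t within {0..1}) (\<lambda>s. frechet_derivative g (at s) 1)"
      using continuous_at_imp_continuous_at_within by blast
    obtain d where d: "d > 0" "ball t d \<subseteq> U" using U(1,2) openE by blast
    have "continuous (at t within {0..1}) (\<lambda>t. vector_derivative \<gamma> (at t within {0..1}))"
      by (rule continuous_transform_within[OF c d(1) t])
         (use eq d in \<open>auto simp: dist_commute subset_iff\<close>)
    then show ?thesis using D[OF U(2) t] eq[OF U(2) t] by simp
  qed
  show "t \<in> {0..1} \<Longrightarrow>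
      (\<gamma> has_vector_derivative vector_derivative \<gamma> (at t within {0..1})) (at t within {0..1})"
    by (rule conjunct1[OF *])
  show "continuous_on {0..1} (\<lambda>t. vector_derivative \<gamma> (at t within {0..1}))"
    unfolding continuous_on_eq_continuous_within using conjunct2[OF *] by blast
qed

text \<open>By the fundamental theorem of calculus every admissible curve is at least as long as its
  chord. The given curve has length at most \<open>B\<close>, and it shows that the infimum is over
  a nonempty set.\<close>

lemma riem_dist_bounds:
  assumes \<gamma>: "smooth_on {0..1} \<gamma>" "\<gamma> ` {0..1} \<subseteq> M" "\<gamma> 0 = x" "\<gamma> 1 = y"
    and B: "\<And>t. t \<in> {0..1} \<Longrightarrow> norm (vector_derivative \<gamma> (at t within {0..1})) \<le> B"
  shows "norm (y - x) \<le> riem_dist M x y" "riem_dist M x y \<le> B"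
proof -
  define S where "S = {integral {0..1} (\<lambda>t. norm (vector_derivative \<gamma> (at t within {0..1}))) | \<gamma>.
            smooth_on {0..1} \<gamma> \<and> \<gamma> ` {0..1} \<subseteq> M \<and> \<gamma> 0 = x \<and> \<gamma> 1 = y}"
  have lb: "norm (y - x) \<le> s" if s_in: "s \<in> S" for s
  proof -
    obtain c where c: "smooth_on {0..1} c" "c 0 = x" "c 1 = y"
      and s: "s = integral {0..1} (\<lambda>t. norm (vector_derivative c (at t within {0..1})))"
      using s_in unfolding S_def by blast
    note cont = smooth_on_path_continuous_derivative[OF c(1)]
    have "((\<lambda>t. vector_derivative c (at t within {0..1})) has_integral c 1 - c 0) {0..1}"
      using smooth_on_path_has_vector_derivative[OF c(1)]
      by (intro fundamental_theorem_of_calculus) auto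
    then have "y - x = integral {0..1} (\<lambda>t. vector_derivative c (at t within {0..1}))"
      using c by (simp add: integral_unique)
    then show ?thesis unfolding s
      using cont by (auto intro!: integral_norm_bound_integral integrable_continuous_real continuous_intros)
  qed
  have in_S: "integral {0..1} (\<lambda>t. norm (vector_derivative \<gamma> (at t within {0..1}))) \<in> S" (is "?I \<in> S")
    unfolding S_def using \<gamma> by blast
  have rd: "riem_dist M x y = Inf S" by (simp add: riem_dist_def S_def)
  show "norm (y - x) \<le> riem_dist M x y"
    unfolding rd using in_S lb by (intro cInf_greatest) auto
  have "?I \<le> integral {0..1} (\<lambda>t::real. B)"
    using smooth_on_path_continuous_derivative[OF \<gamma>(1)] B
    by (intro integral_le integrable_continuous_real continuous_intros) auto
  then have "?I \<le> B" by simp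
  moreover have "Inf S \<le> ?I" using in_S lb by (intro cInf_lower bdd_belowI) auto
  ultimately show "riem_dist M x y \<le> B" unfolding rd by simp
qed

subsection \<open>Linear families and curves\<close>

text \<open>Expanding \<open>a x\<close> in the basis gives a finite sum of products of
  differentiable functions. It serves \<open>oblique\<close>, where a derivative of \<psi> varying
  with \<open>x\<close> acts on a vector varying with \<open>x\<close>.\<close>

lemma differentiable_linear_family_apply:
  fixes A :: "'c::real_normed_vector \<Rightarrow> 'a::euclidean_space \<Rightarrow> 'b::real_normed_vector"
  assumes "open U" "p \<in> U" "\<And>x. x \<in> U \<Longrightarrow> linear (A x)"
    and "\<And>i. i \<in> Basis \<Longrightarrow> (\<lambda>x. A x i) differentiable (at p)" "a differentiable (at p)"
  shows "(\<lambda>x. A x (a x)) differentiable (at p)"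
proof -
  obtain d where d: "d > 0" "ball p d \<subseteq> U" using assms(1,2) openE by blast
  have eq: "(\<Sum>i\<in>Basis. (a x \<bullet> i) *\<^sub>R A x i) = A x (a x)" if "x \<in> U" for x
  proof -
    have "(\<Sum>i\<in>Basis. (a x \<bullet> i) *\<^sub>R A x i) = A x (\<Sum>i\<in>Basis. (a x \<bullet> i) *\<^sub>R i)"
      by (simp add: linear_sum[OF assms(3)[OF that]] linear_cmul[OF assms(3)[OF that]])
    then show ?thesis by (simp add: euclidean_representation)
  qed
  have "(\<lambda>x. \<Sum>i\<in>Basis. (a x \<bullet> i) *\<^sub>R A x i) differentiable (at p)"
    using assms(4,5) by (intro differentiable_sum differentiable_scaleR differentiable_inner) auto
  then show ?thesis
    by (rule differentiable_transform_within[OF _ d(1)])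
       (use d(2) eq in \<open>auto simp: dist_commute subset_iff\<close>)
qed

text \<open>Implicit differentiation of a linear equation. The uniform lower bound on
  \<open>L x\<close> controls the error of the candidate derivative directly, so the inverses of
  \<open>L x\<close> need not be differentiated.\<close>

lemma differentiable_implicit_linear:
  fixes L :: "'c::real_normed_vector \<Rightarrow> 'a::euclidean_space \<Rightarrow> 'a"
  assumes p: "p \<in> X" and lin: "\<And>x. x \<in> X \<Longrightarrow> linear (L x)"
    and coercive: "\<And>x y. x \<in> X \<Longrightarrow> norm y \<le> norm (L x y)"
    and L: "\<And>i. i \<in> Basis \<Longrightarrow> (\<lambda>x. L x i) differentiable (at p within X)"
    and b: "b differentiable (at p within X)" and eq: "\<And>x. x \<in> X \<Longrightarrow> L x (h x) = b x"
  shows "h differentiable (at p within X)"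
proof -
  have rep: "L x y - L p y = (\<Sum>i\<in>Basis. (y \<bullet> i) *\<^sub>R (L x i - L p i))" if "x \<in> X" for x y
  proof -
    have "L x y = (\<Sum>i\<in>Basis. (y \<bullet> i) *\<^sub>R L x i)" if "x \<in> X" for x
    proof -
      have "L x y = L x (\<Sum>i\<in>Basis. (y \<bullet> i) *\<^sub>R i)" by (simp add: euclidean_representation)
      also have "\<dots> = (\<Sum>i\<in>Basis. (y \<bullet> i) *\<^sub>R L x i)"
        by (simp only: linear_sum[OF lin[OF that]] linear_cmul[OF lin[OF that]])
      finally show ?thesis .
    qed
    from this[OF that] this[OF p] show ?thesis by (simp add: scaleR_diff_right sum_subtractf)
  qed
  \<comment> \<open>This is \<open>b x - L x (h p)\<close>, written in the basis because only the
    functions \<open>L x i\<close> are known to be differentiable.\<close>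
  define r where "r = (\<lambda>x. b x - (\<Sum>i\<in>Basis. (h p \<bullet> i) *\<^sub>R L x i))"
  have r_eq: "r x = L x (h x - h p)" if "x \<in> X" for x
  proof -
    have "(\<Sum>i\<in>Basis. (h p \<bullet> i) *\<^sub>R L x i) = L x (\<Sum>i\<in>Basis. (h p \<bullet> i) *\<^sub>R i)"
      by (simp only: linear_sum[OF lin[OF that]] linear_cmul[OF lin[OF that]])
    then show ?thesis
      by (simp add: r_def eq[OF that, symmetric] euclidean_representation linear_diff[OF lin[OF that], of "h x" "h p"])
  qed
  have "r differentiable (at p within X)"
    unfolding r_def using L b
    by (intro differentiable_diff differentiable_sum differentiable_scaleR differentiable_const) auto
  then obtain r' where r': "(r has_derivative r') (at p within X)" by (auto simp: differentiable_def)
  have "inj (L p)"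
    using coercive[OF p] by (subst linear_injective_0[OF lin[OF p]]) (metis norm_le_zero_iff norm_zero)
  then obtain N where N: "linear N" "\<And>y. L p (N y) = y"
    using linear_injective_isomorphism[OF lin[OF p]] by blast
  \<comment> \<open>Differentiating \<open>r x = L x (h x - h p)\<close> at \<open>p\<close>, where
    the argument of \<open>L x\<close> vanishes, suggests that \<open>L p\<close> maps the
    derivative of \<open>h\<close> to \<open>r'\<close>.\<close>
  define k where "k = (\<lambda>v. N (r' v))"
  have bk: "bounded_linear k"
    unfolding k_def
    by (rule bounded_linear_compose[OF N(1)[unfolded linear_conv_bounded_linear] has_derivative_bounded_linear[OF r']])
  then obtain K where K: "\<And>v. norm (k v) \<le> norm v * K" using bounded_linear.bounded by blast
  have rp: "r p = 0" using r_eq[OF p] linear_0[OF lin[OF p]] by simp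
  define s where "s = (\<lambda>x. \<Sum>i\<in>Basis. norm (L x i - L p i))"
  have s: "(s \<longlongrightarrow> 0) (at p within X)"
  proof -
    have "((\<lambda>x. L x i) \<longlongrightarrow> L p i) (at p within X)" if "i \<in> Basis" for i
      using differentiable_imp_continuous_within[OF L[OF that]] by (simp add: continuous_within)
    then have "((\<lambda>x. \<Sum>i\<in>Basis. norm (L x i - L p i)) \<longlongrightarrow> (\<Sum>i\<in>(Basis::'a set). 0)) (at p within X)"
      by (intro tendsto_sum tendsto_norm_zero LIM_zero)
    then show ?thesis by (simp add: s_def)
  qed
  \<comment> \<open>\<open>L x\<close> maps the error to the first-order remainder of
    \<open>r\<close> minus \<open>L x - L p\<close> applied to \<open>k (x - p)\<close>; the factor
    \<open>s x\<close> makes the latter negligible.\<close>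
  have bound: "norm (h x - (h p + k (x - p))) \<le> norm (r x - (r p + r' (x - p))) + norm (x - p) * (K * s x)"
    if x: "x \<in> X" for x
  proof -
    have "L x (h x - (h p + k (x - p))) = r x - L x (k (x - p))"
      using linear_diff[OF lin[OF x], of "h x - h p" "k (x - p)"] r_eq[OF x] by (simp add: algebra_simps)
    also have "\<dots> = (r x - (r p + r' (x - p))) - (L x (k (x - p)) - L p (k (x - p)))"
      using N(2) by (simp add: rp k_def)
    finally have "norm (h x - (h p + k (x - p))) \<le>
        norm (r x - (r p + r' (x - p))) + norm (L x (k (x - p)) - L p (k (x - p)))"
      using coercive[OF x, of "h x - (h p + k (x - p))"] norm_triangle_ineq4 order_trans by metis
    also have "norm (L x (k (x - p)) - L p (k (x - p))) \<le> (\<Sum>i\<in>Basis. norm (k (x - p)) * norm (L x i - L p i))"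
      by (subst rep[OF x], rule sum_norm_le) (simp add: mult_right_mono Basis_le_norm)
    also have "\<dots> = norm (k (x - p)) * s x" by (simp add: s_def sum_distrib_left)
    also have "\<dots> \<le> norm (x - p) * K * s x"
      by (rule mult_right_mono[OF K]) (simp add: s_def sum_nonneg)
    finally show ?thesis by (simp add: mult.assoc)
  qed
  have "(h has_derivative k) (at p within X)"
    unfolding has_derivative_within
  proof (intro conjI bk)
    have 1: "((\<lambda>y. norm ((1 / norm (y - p)) *\<^sub>R (r y - (r p + r' (y - p)))) + K * s y) \<longlongrightarrow> 0) (at p within X)"
      using r' s unfolding has_derivative_within
      by (intro tendsto_add_zero tendsto_norm_zero tendsto_mult_right_zero) auto
    show "((\<lambda>y. (1 / norm (y - p)) *\<^sub>R (h y - (h p + k (y - p)))) \<longlongrightarrow> 0) (at p within X)"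
    proof (rule Lim_null_comparison[OF _ 1])
      have "norm ((1 / norm (y - p)) *\<^sub>R (h y - (h p + k (y - p))))
          \<le> norm ((1 / norm (y - p)) *\<^sub>R (r y - (r p + r' (y - p)))) + K * s y"
        if "y \<in> X" "y \<noteq> p" for y
      proof -
        have n: "norm (y - p) > 0" using that(2) by simp
        have "norm (h y - (h p + k (y - p))) / norm (y - p)
            \<le> (norm (r y - (r p + r' (y - p))) + norm (y - p) * (K * s y)) / norm (y - p)"
          using bound[OF that(1)] n by (intro divide_right_mono) auto
        also have "\<dots> = norm (r y - (r p + r' (y - p))) / norm (y - p) + K * s y"
          using n by (simp add: add_divide_distrib)
        finally show ?thesis by simp
      qed
      then show "\<forall>\<^sub>F y in at p within X. norm ((1 / norm (y - p)) *\<^sub>R (h y - (h p + k (y - p))))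
          \<le> norm ((1 / norm (y - p)) *\<^sub>R (r y - (r p + r' (y - p)))) + K * s y"
        by (auto simp: eventually_at_filter)
    qed
  qed
  then show ?thesis by (auto simp: differentiable_def)
qed

lemma curve_through_has_derivative:
  assumes "curve_through M x \<gamma>"
  shows "(\<gamma> has_vector_derivative vector_derivative \<gamma> (at 0)) (at 0)"
proof -
  obtain e where e: "e > 0" "smooth_on {-e<..<e} \<gamma>"
    using assms by (auto simp: curve_through_def)
  have "Ck_on (Suc 0) {-e<..<e} \<gamma>" by (rule smooth_on_open) (use e in auto)
  then have "\<gamma> differentiable (at 0)" using e(1) by simp
  then show ?thesis using vector_derivative_works by blast
qed

lemma curve_through_eventually:
  assumes "curve_through M x \<gamma>" "open U" "x \<in> U"
  shows "\<forall>\<^sub>F t in nhds 0. \<gamma> t \<in> M \<inter> U"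
proof -
  obtain e where e: "e > 0" "\<gamma> ` {-e<..<e} \<subseteq> M" "\<gamma> 0 = x"
    using assms by (auto simp: curve_through_def)
  have "isCont \<gamma> 0"
    using curve_through_has_derivative[OF assms(1)] has_vector_derivative_continuous by blast
  then have "(\<gamma> \<longlongrightarrow> x) (nhds 0)" using e(3) tendsto_at_iff_tendsto_nhds isCont_def by metis
  then have "\<forall>\<^sub>F t in nhds 0. \<gamma> t \<in> U" using assms(2,3) topological_tendstoD by blast
  moreover have "\<forall>\<^sub>F t in nhds 0. t \<in> {-e<..<e}"
    using e(1) by (intro eventually_nhds_in_open) auto
  ultimately show ?thesis by eventually_elim (use e(2) in auto)
qed

lemma has_real_derivative_along_curve:
  assumes \<gamma>: "curve_through M x \<gamma>" and "open W" "x \<in> W"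
    and G: "(G has_derivative (\<lambda>h. c \<bullet> h)) (at x)" "\<forall>y\<in>W \<inter> M. G y = F y"
  shows "((\<lambda>t. F (\<gamma> t)) has_real_derivative c \<bullet> vector_derivative \<gamma> (at 0)) (at 0)"
proof -
  have x: "\<gamma> 0 = x" using \<gamma> by (simp add: curve_through_def)
  have "((\<lambda>t. G (\<gamma> t)) has_derivative (\<lambda>t. c \<bullet> (t *\<^sub>R vector_derivative \<gamma> (at 0)))) (at 0)"
    using curve_through_has_derivative[OF \<gamma>] G(1)
    by (intro has_derivative_compose[of \<gamma> _ 0 UNIV G]) (auto simp: has_vector_derivative_def x)
  then have "((\<lambda>t. G (\<gamma> t)) has_real_derivative c \<bullet> vector_derivative \<gamma> (at 0)) (at 0)"
    by (simp add: has_field_derivative_def mult_commute_abs)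
  moreover have "\<forall>\<^sub>F t in nhds 0. G (\<gamma> t) = F (\<gamma> t)"
    using curve_through_eventually[OF \<gamma> assms(2,3)] by eventually_elim (use G(2) in auto)
  ultimately show ?thesis by (simp add: DERIV_cong_ev)
qed

subsection \<open>Geometry in a slice chart\<close>

text \<open>The claim is local, so one chart around the minimizer carries the whole
  argument.\<close>

locale slice_chart =
  fixes M U V S :: "'a::euclidean_space set" and \<phi> \<psi> :: "'a \<Rightarrow> 'a"
  assumes open_U: "open U" and open_V: "open V"
    and homeo: "homeomorphism U V \<phi> \<psi>"
    and smooth_phi: "smooth_on U \<phi>" and smooth_psi: "smooth_on V \<psi>"
    and subspace_S: "subspace S" and image_slice: "\<phi> ` (U \<inter> M) = V \<inter> S"
begin

abbreviation "d\<phi> x \<equiv> frechet_derivative \<phi> (at x)"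
abbreviation "d\<psi> s \<equiv> frechet_derivative \<psi> (at s)"

lemma phi_in [simp]: "x \<in> U \<Longrightarrow> \<phi> x \<in> V"
  and psi_in [simp]: "s \<in> V \<Longrightarrow> \<psi> s \<in> U"
  and psi_phi [simp]: "x \<in> U \<Longrightarrow> \<psi> (\<phi> x) = x"
  and phi_psi [simp]: "s \<in> V \<Longrightarrow> \<phi> (\<psi> s) = s"
  using homeo by (auto simp: homeomorphism_def)

lemma phi_in_S: "x \<in> U \<Longrightarrow> x \<in> M \<Longrightarrow> \<phi> x \<in> S"
  using image_slice by blast

lemma psi_in_M: assumes "s \<in> V" "s \<in> S" shows "\<psi> s \<in> M"
proof -
  obtain x where "x \<in> U" "x \<in> M" "s = \<phi> x" using assms image_slice by blast
  then show ?thesis by simp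
qed

lemma phi_deriv: "x \<in> U \<Longrightarrow> (\<phi> has_derivative d\<phi> x) (at x)"
  by (rule Ck_on_has_derivative[OF smooth_on_open[OF open_U smooth_phi]])

lemma psi_deriv: "s \<in> V \<Longrightarrow> (\<psi> has_derivative d\<psi> s) (at s)"
  by (rule Ck_on_has_derivative[OF smooth_on_open[OF open_V smooth_psi]])

lemma linear_dphi: "x \<in> U \<Longrightarrow> linear (d\<phi> x)"
  by (rule has_derivative_linear[OF phi_deriv])

lemma linear_dpsi: "s \<in> V \<Longrightarrow> linear (d\<psi> s)"
  by (rule has_derivative_linear[OF psi_deriv])

lemma dpsi_dphi: assumes "x \<in> U" shows "d\<psi> (\<phi> x) (d\<phi> x v) = v"
proof -
  have "((\<lambda>y. \<psi> (\<phi> y)) has_derivative (\<lambda>v. d\<psi> (\<phi> x) (d\<phi> x v))) (at x)"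
    using assms by (intro has_derivative_compose[of \<phi> _ x UNIV \<psi>] phi_deriv psi_deriv) auto
  then have "((\<lambda>y. y) has_derivative (\<lambda>v. d\<psi> (\<phi> x) (d\<phi> x v))) (at x)"
    by (rule has_derivative_transform_within_open[OF _ open_U assms]) auto
  from has_derivative_unique[OF this has_derivative_ident] show ?thesis by meson
qed

lemma dphi_dpsi: assumes "x \<in> U" shows "d\<phi> x (d\<psi> (\<phi> x) v) = v"
proof -
  have "((\<lambda>s. \<phi> (\<psi> s)) has_derivative (\<lambda>v. d\<phi> (\<psi> (\<phi> x)) (d\<psi> (\<phi> x) v))) (at (\<phi> x))"
    using assms by (intro has_derivative_compose[of \<psi> _ _ UNIV \<phi>] phi_deriv psi_deriv) auto
  then have "((\<lambda>s. s) has_derivative (\<lambda>v. d\<phi> x (d\<psi> (\<phi> x) v))) (at (\<phi> x))"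
    unfolding psi_phi[OF assms]
    by (rule has_derivative_transform_within_open[OF _ open_V]) (use assms in auto)
  from has_derivative_unique[OF this has_derivative_ident] show ?thesis by meson
qed

text \<open>These curves realise all tangent vectors and later carry the expansion of
  \<open>F\<close>; they stay on \<open>M\<close> because \<open>S\<close> is a subspace.\<close>

lemma coordinate_line:
  assumes "x \<in> U" "x \<in> M" "\<sigma> \<in> S"
  shows "curve_through M x (\<lambda>t. \<psi> (\<phi> x + t *\<^sub>R \<sigma>))"
    and "vector_derivative (\<lambda>t. \<psi> (\<phi> x + t *\<^sub>R \<sigma>)) (at 0) = d\<psi> (\<phi> x) \<sigma>"
proof -
  have "open {t::real. \<phi> x + t *\<^sub>R \<sigma> \<in> V}"
    using continuous_open_vimage[of V "\<lambda>t. \<phi> x + t *\<^sub>R \<sigma>"] open_V by (simp add: vimage_def)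
  moreover have "0 \<in> {t::real. \<phi> x + t *\<^sub>R \<sigma> \<in> V}" using assms by simp
  ultimately obtain e where e: "e > 0" "ball 0 e \<subseteq> {t::real. \<phi> x + t *\<^sub>R \<sigma> \<in> V}"
    using openE by blast
  have V: "\<phi> x + t *\<^sub>R \<sigma> \<in> V" if "t \<in> {-e<..<e}" for t
    using e(2) that by (auto simp: subset_iff dist_norm)
  have "\<psi> (\<phi> x + t *\<^sub>R \<sigma>) \<in> M" if "t \<in> {-e<..<e}" for t
    using psi_in_M[OF V[OF that]] phi_in_S assms subspace_S by (simp add: subspace_add subspace_scale)
  then show "curve_through M x (\<lambda>t. \<psi> (\<phi> x + t *\<^sub>R \<sigma>))"
    using e(1) assms smooth_on_affine[OF smooth_psi V, of "{-e<..<e}"]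
    unfolding curve_through_def by (intro conjI exI[of _ e]) auto
  have "((\<lambda>t. \<psi> (\<phi> x + t *\<^sub>R \<sigma>)) has_derivative (\<lambda>t. d\<psi> (\<phi> x) (t *\<^sub>R \<sigma>))) (at 0)"
    by (rule has_derivative_compose[where f = "\<lambda>t. \<phi> x + t *\<^sub>R \<sigma>"])
       (use assms psi_deriv in \<open>auto intro!: derivative_eq_intros\<close>)
  then have "((\<lambda>t. \<psi> (\<phi> x + t *\<^sub>R \<sigma>)) has_vector_derivative d\<psi> (\<phi> x) \<sigma>) (at 0)"
    using assms by (simp add: has_vector_derivative_def linear_cmul[OF linear_dpsi])
  then show "vector_derivative (\<lambda>t. \<psi> (\<phi> x + t *\<^sub>R \<sigma>)) (at 0) = d\<psi> (\<phi> x) \<sigma>"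
    by (rule vector_derivative_at)
qed

text \<open>A linear projection onto \<open>S\<close> turns membership in \<open>S\<close> into the
  equation \<open>proj_S s = s\<close>, which can be differentiated along curves.\<close>

definition proj_S :: "'a \<Rightarrow> 'a" where
  "proj_S = (SOME p. linear p \<and> range p \<subseteq> S \<and> (\<forall>x\<in>S. p x = x))"

lemma proj_S: "linear proj_S" "proj_S x \<in> S" "x \<in> S \<Longrightarrow> proj_S x = x"
proof -
  have "\<exists>p. linear p \<and> range p \<subseteq> S \<and> (\<forall>x\<in>S. p x = x)"
    using linear_exists_left_inverse_on[OF linear_id subspace_S] by auto
  then have "linear proj_S \<and> range proj_S \<subseteq> S \<and> (\<forall>x\<in>S. proj_S x = x)"
    unfolding proj_S_def by (rule someI_ex)
  then show "linear proj_S" "proj_S x \<in> S" "x \<in> S \<Longrightarrow> proj_S x = x" by auto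
qed

text \<open>In the chart a curve on \<open>M\<close> is fixed by \<open>proj_S\<close>, hence so is
  its velocity. Conversely, the coordinate line in direction \<open>d\<phi> x v\<close> has velocity
  \<open>v\<close>.\<close>

lemma tangent_space_iff:
  assumes x: "x \<in> U" "x \<in> M"
  shows "v \<in> tangent_space M x \<longleftrightarrow> d\<phi> x v \<in> S"
proof
  assume "v \<in> tangent_space M x"
  then obtain \<gamma> where \<gamma>: "curve_through M x \<gamma>" and v: "v = vector_derivative \<gamma> (at 0)"
    by (auto simp: tangent_space_def)
  have x0: "\<gamma> 0 = x" using \<gamma> by (simp add: curve_through_def)
  have D: "((\<lambda>t. \<phi> (\<gamma> t)) has_derivative (\<lambda>t. d\<phi> x (t *\<^sub>R v))) (at 0)"
    using curve_through_has_derivative[OF \<gamma>] phi_deriv[OF x(1)]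
    by (intro has_derivative_compose[of \<gamma> _ 0 UNIV \<phi>]) (auto simp: has_vector_derivative_def x0 v)
  then have 1: "((\<lambda>t. proj_S (\<phi> (\<gamma> t))) has_derivative (\<lambda>t. proj_S (d\<phi> x (t *\<^sub>R v)))) (at 0)"
    by (rule bounded_linear.has_derivative[OF proj_S(1)[unfolded linear_conv_bounded_linear]])
  have "\<forall>\<^sub>F t in nhds 0. proj_S (\<phi> (\<gamma> t)) = \<phi> (\<gamma> t)"
    using curve_through_eventually[OF \<gamma> open_U x(1)] by eventually_elim (auto simp: proj_S(3) phi_in_S)
  then have "((\<lambda>t. \<phi> (\<gamma> t)) has_derivative (\<lambda>t. proj_S (d\<phi> x (t *\<^sub>R v)))) (at 0)"
    using eventually_nhds_x_imp_x
    by (intro has_derivative_transform_eventually[OF 1]) (auto simp: eventually_at_filter elim: eventually_mono)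
  from has_derivative_unique[OF D this] have "d\<phi> x (1 *\<^sub>R v) = proj_S (d\<phi> x (1 *\<^sub>R v))" by meson
  then show "d\<phi> x v \<in> S" using proj_S(2) by (metis scaleR_one)
next
  assume "d\<phi> x v \<in> S"
  then show "v \<in> tangent_space M x"
    using coordinate_line[OF x] dpsi_dphi[OF x(1)] unfolding tangent_space_def by (metis (mono_tags, lifting) mem_Collect_eq)
qed

lemma subspace_tangent_space:
  assumes "x \<in> U" "x \<in> M"
  shows "subspace (tangent_space M x)"
proof -
  have "tangent_space M x = {v. d\<phi> x v \<in> S}" using tangent_space_iff[OF assms] by blast
  then show ?thesis
    using linear_subspace_vimage[OF linear_dphi[OF assms(1)] subspace_S] by (simp add: vimage_def)
qed

text \<open>A projection onto the tangent space that is not orthogonal but visibly smooth in the base point.\<close>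

definition oblique :: "'a \<Rightarrow> 'a \<Rightarrow> 'a" where
  "oblique x v = d\<psi> (\<phi> x) (proj_S (d\<phi> x v))"

lemma linear_oblique: assumes "x \<in> U" shows "linear (oblique x)"
  unfolding oblique_def
  using linear_compose[OF linear_compose[OF linear_dphi[OF assms] proj_S(1)] linear_dpsi[OF phi_in[OF assms]]]
  by (simp add: o_def)

lemma oblique_tangent: "x \<in> U \<Longrightarrow> x \<in> M \<Longrightarrow> oblique x v \<in> tangent_space M x"
  by (simp add: tangent_space_iff oblique_def dphi_dpsi proj_S(2))

lemma oblique_id: "x \<in> U \<Longrightarrow> x \<in> M \<Longrightarrow> v \<in> tangent_space M x \<Longrightarrow> oblique x v = v"
  by (simp add: tangent_space_iff oblique_def dpsi_dphi proj_S(3))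

text \<open>Second-order smoothness of the chart enters here, since \<open>oblique\<close> is built
  from first derivatives of \<phi> and \<psi>.\<close>

lemma differentiable_oblique:
  assumes "x \<in> U"
  shows "(\<lambda>x. oblique x v) differentiable (at x)"
proof -
  have 1: "(\<lambda>x. d\<phi> x v) differentiable (at x)"
    using smooth_on_open[OF open_U smooth_phi, of "Suc (Suc 0)"] assms by simp
  have "(\<lambda>s. d\<psi> s i) differentiable (at (\<phi> x))" for i
    using smooth_on_open[OF open_V smooth_psi, of "Suc (Suc 0)"] assms by simp
  moreover have "\<phi> differentiable (at x)" using phi_deriv[OF assms] by (auto simp: differentiable_def)
  ultimately have 2: "(\<lambda>x. d\<psi> (\<phi> x) i) differentiable (at x)" for i
    using differentiable_compose[of "\<lambda>s. d\<psi> s i" \<phi> x UNIV] by simp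
  have 3: "(\<lambda>x. proj_S (d\<phi> x v)) differentiable (at x)"
    using differentiable_compose[OF linear_imp_differentiable[OF proj_S(1)] 1] .
  show ?thesis
    unfolding oblique_def
    by (rule differentiable_linear_family_apply[OF open_U assms linear_dpsi[OF phi_in] 2 3])
qed

section \<open>Riemannian gradient and Hessian\<close>

text \<open>The witness is the orthogonal projection of the Euclidean gradient \<open>c\<close> onto
  the tangent space. Two candidates differ by a tangent vector orthogonal to itself, so
  \<open>THE\<close> is well defined.\<close>

lemma rgrad_characterization:
  assumes x: "x \<in> U" "x \<in> M" and W: "open W" "x \<in> W"
    and G: "(G has_derivative (\<lambda>h. c \<bullet> h)) (at x)" "\<forall>y\<in>W \<inter> M. G y = F y"
  shows "rgrad M F x \<in> tangent_space M x"
    and "\<And>v. v \<in> tangent_space M x \<Longrightarrow> rgrad M F x \<bullet> v = c \<bullet> v"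
    and "\<And>\<gamma>. curve_through M x \<gamma> \<Longrightarrow>
      ((\<lambda>t. F (\<gamma> t)) has_real_derivative rgrad M F x \<bullet> vector_derivative \<gamma> (at 0)) (at 0)"
proof -
  let ?T = "tangent_space M x"
  have T: "subspace ?T" by (rule subspace_tangent_space[OF x])
  define P where "P = (\<lambda>g. g \<in> ?T \<and> (\<forall>\<gamma>. curve_through M x \<gamma> \<longrightarrow>
        ((\<lambda>t. F (\<gamma> t)) has_real_derivative g \<bullet> vector_derivative \<gamma> (at 0)) (at 0)))"
  have D: "((\<lambda>t. F (\<gamma> t)) has_real_derivative c \<bullet> vector_derivative \<gamma> (at 0)) (at 0)"
    if "curve_through M x \<gamma>" for \<gamma>
    using has_real_derivative_along_curve[OF that W G] .
  have inner_eq: "g \<bullet> v = c \<bullet> v" if "P g" "v \<in> ?T" for g v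
    using that D DERIV_unique unfolding P_def tangent_space_def by blast
  obtain g z where g: "g \<in> span ?T" "\<And>w. w \<in> span ?T \<Longrightarrow> orthogonal z w" "c = g + z"
    using orthogonal_subspace_decomp_exists[of ?T c] by blast
  have gT: "g \<in> ?T" using g(1) T by (metis span_eq_iff)
  have "g \<bullet> v = c \<bullet> v" if "v \<in> ?T" for v
    using g(2)[OF span_base[OF that]] by (simp add: g(3) inner_add_left orthogonal_def)
  moreover have "vector_derivative \<gamma> (at 0) \<in> ?T" if "curve_through M x \<gamma>" for \<gamma>
    using that unfolding tangent_space_def by blast
  ultimately have "P g" unfolding P_def using gT D by simp
  have "g' = g" if "P g'" for g'
  proof -
    have "g' - g \<in> ?T" using that gT T unfolding P_def by (simp add: subspace_diff)
    then have "(g' - g) \<bullet> (g' - g) = 0"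
      using inner_eq[OF that] inner_eq[OF \<open>P g\<close>] by (simp add: inner_diff_left)
    then show ?thesis by simp
  qed
  then have "P (rgrad M F x)"
    unfolding rgrad_def P_def[symmetric] using \<open>P g\<close> by (metis theI')
  then show "rgrad M F x \<in> ?T"
    and "\<And>v. v \<in> ?T \<Longrightarrow> rgrad M F x \<bullet> v = c \<bullet> v"
    and "\<And>\<gamma>. curve_through M x \<gamma> \<Longrightarrow>
      ((\<lambda>t. F (\<gamma> t)) has_real_derivative rgrad M F x \<bullet> vector_derivative \<gamma> (at 0)) (at 0)"
    using inner_eq unfolding P_def by blast+
qed

lemma rgrad_differentiable:
  assumes xs: "xs \<in> U" "xs \<in> M" and W: "open W" "xs \<in> W"
    and G: "\<And>y. y \<in> W \<Longrightarrow> (G has_derivative (\<lambda>h. g y \<bullet> h)) (at y)"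
    and g: "g differentiable (at xs)" and GF: "\<forall>y\<in>W \<inter> M. G y = F y"
  shows "rgrad M F differentiable (at xs within M)"
proof -
  \<comment> \<open>With \<open>A\<close> the oblique projection, \<open>h\<close> the Riemannian and \<open>g\<close> the Euclidean gradient:
    \<open>A h = h\<close> and \<open>g - h\<close> is orthogonal to the range of \<open>A\<close>, so \<open>(I - A + A\<^sup>T) h = A\<^sup>T g\<close>, where
    \<open>I - A + A\<^sup>T\<close> is bounded below because \<open>A - A\<^sup>T\<close> is skew.\<close>
  define X where "X = M \<inter> (U \<inter> W)"
  \<comment> \<open>The sum is the adjoint of \<open>oblique x\<close> applied to \<open>y\<close>,
    in coordinates that display its dependence on \<open>x\<close>.\<close>
  define L where "L = (\<lambda>x y. y - oblique x y + (\<Sum>i\<in>Basis. (oblique x i \<bullet> y) *\<^sub>R i))"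
  define b where "b = (\<lambda>x. \<Sum>i\<in>Basis. (oblique x i \<bullet> g x) *\<^sub>R (i::'a))"
  have X: "x \<in> U" "x \<in> M" "x \<in> W" if "x \<in> X" for x using that by (auto simp: X_def)
  have "rgrad M F differentiable (at xs within X)"
  proof (rule differentiable_implicit_linear)
    show "xs \<in> X" using xs W by (simp add: X_def)
    fix x assume x: "x \<in> X"
    note lo = linear_oblique[OF X(1)[OF x]]
    show "linear (L x)"
      by (rule linearI) (simp_all add: L_def linear_add[OF lo] linear_cmul[OF lo]
          inner_add_right scaleR_add_left sum.distrib scaleR_sum_right scaleR_diff_right scaleR_add_right)
    show "norm y \<le> norm (L x y)" for y
    proof -
      have "oblique x y = (\<Sum>i\<in>Basis. (y \<bullet> i) *\<^sub>R oblique x i)"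
        by (simp only: linear_sum[OF lo, symmetric] linear_cmul[OF lo, symmetric] euclidean_representation)
      then have "oblique x y \<bullet> y = (\<Sum>i\<in>Basis. (y \<bullet> i) *\<^sub>R oblique x i) \<bullet> y" by simp
      then have "oblique x y \<bullet> y = (\<Sum>i\<in>Basis. (oblique x i \<bullet> y) * (i \<bullet> y))"
        by (simp add: inner_sum_left inner_commute[of y] mult.commute)
      then have "L x y \<bullet> y = y \<bullet> y"
        by (simp add: L_def inner_add_left inner_diff_left inner_sum_left)
      then have "norm y * norm y \<le> norm (L x y) * norm y"
        using norm_cauchy_schwarz[of "L x y" y] by (simp add: power2_norm_eq_inner[symmetric] power2_eq_square)
      then show ?thesis by (cases "y = 0") auto
    qed
    note grad = rgrad_characterization[OF X(1,2)[OF x] W(1) X(3)[OF x] G[OF X(3)[OF x]] GF]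
    show "L x (rgrad M F x) = b x"
      using grad(2)[OF oblique_tangent[OF X(1,2)[OF x]]] oblique_id[OF X(1,2)[OF x] grad(1)]
      by (simp add: L_def b_def inner_commute)
  next
    fix i :: 'a
    have *: "(\<lambda>x. oblique x j) differentiable (at xs within X)" for j
      using differentiable_oblique[OF xs(1)] differentiable_at_withinI by blast
    have "(\<lambda>x. \<Sum>j\<in>Basis. (oblique x j \<bullet> i) *\<^sub>R (j::'a)) differentiable (at xs within X)"
      by (intro differentiable_sum ballI differentiable_scaleR differentiable_inner * differentiable_const) simp
    then show "(\<lambda>x. L x i) differentiable (at xs within X)"
      unfolding L_def by (intro differentiable_add differentiable_diff differentiable_const *)
    show "b differentiable (at xs within X)"
      unfolding b_def using differentiable_at_withinI[OF g]
      by (intro differentiable_sum ballI differentiable_scaleR differentiable_inner * differentiable_const) simp_all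
  qed
  moreover have "at xs within X = at xs within M"
    using xs W open_U by (intro at_within_nhd[of _ "U \<inter> W"]) (auto simp: X_def)
  ultimately show ?thesis by simp
qed

text \<open>\<open>rhess\<close> is the tangential part of \<open>H v\<close>; the discarded normal
  part vanishes against the tangent vector \<open>v\<close>.\<close>

lemma rhess_inner:
  assumes xs: "xs \<in> U" "xs \<in> M" and v: "v \<in> tangent_space M xs"
    and H: "(rgrad M F has_derivative H) (at xs within M)"
  shows "rhess M F xs v \<bullet> v = H v \<bullet> v"
proof -
  let ?T = "tangent_space M xs"
  have T: "subspace ?T" by (rule subspace_tangent_space[OF xs])
  define P where "P = (\<lambda>w. w \<in> ?T \<and>
     (\<forall>\<gamma>. curve_through M xs \<gamma> \<and> vector_derivative \<gamma> (at 0) = v \<longrightarrow>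
        (\<exists>D. ((\<lambda>t. rgrad M F (\<gamma> t)) has_vector_derivative D) (at 0) \<and>
             (\<forall>u\<in>?T. orthogonal u (D - w)))))"
  have D: "((\<lambda>t. rgrad M F (\<gamma> t)) has_vector_derivative H v) (at 0)"
    if \<gamma>: "curve_through M xs \<gamma>" "vector_derivative \<gamma> (at 0) = v" for \<gamma>
  proof -
    obtain e where e: "e > 0" "\<gamma> ` {-e<..<e} \<subseteq> M" "\<gamma> 0 = xs"
      using \<gamma>(1) by (auto simp: curve_through_def)
    \<comment> \<open>\<open>H\<close> is a derivative within \<open>M\<close> only, so the chain
      rule is applied on an interval whose image lies in \<open>M\<close>.\<close>
    have "(\<gamma> has_derivative (\<lambda>t. t *\<^sub>R v)) (at 0 within {-e<..<e})"
      using curve_through_has_derivative[OF \<gamma>(1)] \<gamma>(2)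
      by (simp add: has_vector_derivative_def has_derivative_at_withinI)
    moreover have "(rgrad M F has_derivative H) (at (\<gamma> 0) within \<gamma> ` {-e<..<e})"
      using has_derivative_subset[OF H e(2)] e(3) by simp
    ultimately have "((\<lambda>t. rgrad M F (\<gamma> t)) has_derivative (\<lambda>t. H (t *\<^sub>R v))) (at 0 within {-e<..<e})"
      by (rule has_derivative_in_compose)
    moreover have "at 0 within {-e<..<e} = at 0" using e(1) by (intro at_within_open) auto
    ultimately show ?thesis
      by (simp add: has_vector_derivative_def linear_cmul[OF has_derivative_linear[OF H]])
  qed
  \<comment> \<open>Without such a curve the second clause of \<open>P\<close> would be vacuous and
    would not determine \<open>w\<close>.\<close>
  obtain \<gamma> where \<gamma>: "curve_through M xs \<gamma>" "vector_derivative \<gamma> (at 0) = v"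
    using v by (auto simp: tangent_space_def)
  have orth: "u \<bullet> (H v - w) = 0" if "P w" "u \<in> ?T" for w u
    using that \<gamma> D[OF \<gamma>] vector_derivative_unique_at unfolding P_def orthogonal_def by blast
  obtain w z where w: "w \<in> span ?T" "\<And>u. u \<in> span ?T \<Longrightarrow> orthogonal z u" "H v = w + z"
    using orthogonal_subspace_decomp_exists[of ?T "H v"] by blast
  have wT: "w \<in> ?T" using w(1) T by (metis span_eq_iff)
  have "\<forall>u\<in>?T. orthogonal u (H v - w)"
    using w(2)[OF span_base] by (simp add: w(3) orthogonal_commute)
  then have "P w" unfolding P_def using wT D by blast
  have "w' = w" if "P w'" for w'
  proof -
    have "w' - w \<in> ?T" using that wT T unfolding P_def by (simp add: subspace_diff)
    then have "(w' - w) \<bullet> (H v - w) = 0" "(w' - w) \<bullet> (H v - w') = 0"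
      using orth that \<open>P w\<close> by blast+
    then have "(w' - w) \<bullet> (w' - w) = 0" by (simp add: inner_diff_right)
    then show ?thesis by simp
  qed
  then have "P (rhess M F xs v)"
    unfolding rhess_def P_def[symmetric] using \<open>P w\<close> by (metis theI')
  from orth[OF this v] show ?thesis by (simp add: inner_diff_right inner_commute)
qed

section \<open>Local estimates for the distance and the retraction\<close>

text \<open>The competitor for the upper bound is the image under \<psi> of the segment from
  \<open>\<phi> y\<close> to \<open>\<phi> xs\<close>. The summands 1 in the constants absorb the
  variation of the chart derivatives near \<open>xs\<close>.\<close>

lemma riem_dist_equivalent_norm:
  assumes xs: "xs \<in> U" "xs \<in> M"
  obtains r K where "r > 0" "K > 0" "\<And>y. y \<in> M \<Longrightarrow> y \<in> ball xs r \<Longrightarrow>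
    norm (y - xs) \<le> riem_dist M y xs \<and> riem_dist M y xs \<le> K * norm (y - xs)"
proof -
  obtain r1 where r1: "r1 > 0" "ball (\<phi> xs) r1 \<subseteq> V" "\<And>s w. s \<in> ball (\<phi> xs) r1 \<Longrightarrow>
      norm (d\<psi> s w - d\<psi> (\<phi> xs) w) \<le> 1 * norm w"
    using C1_derivative_continuous[OF open_V smooth_on_open[OF open_V smooth_psi] phi_in[OF xs(1)], of 1] by auto
  obtain r2 where r2: "r2 > 0" "ball xs r2 \<subseteq> U" "\<And>x y. x \<in> ball xs r2 \<Longrightarrow> y \<in> ball xs r2 \<Longrightarrow>
      norm (\<phi> y - \<phi> x - d\<phi> xs (y - x)) \<le> 1 * norm (y - x)"
    using C1_strictly_differentiable[OF open_U smooth_on_open[OF open_U smooth_phi] xs(1), of 1] by auto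
  obtain K1 where K1: "K1 > 0" "\<And>w. norm (d\<psi> (\<phi> xs) w) \<le> norm w * K1"
    using bounded_linear.pos_bounded[OF has_derivative_bounded_linear[OF psi_deriv[OF phi_in[OF xs(1)]]]] by blast
  obtain K2 where K2: "K2 > 0" "\<And>w. norm (d\<phi> xs w) \<le> norm w * K2"
    using bounded_linear.pos_bounded[OF has_derivative_bounded_linear[OF phi_deriv[OF xs(1)]]] by blast
  \<comment> \<open>This radius puts \<open>\<phi> y\<close> into the ball where the derivative of
    \<psi> is controlled; convexity keeps the segment there.\<close>
  define r where "r = min r2 (r1 / (K2 + 1))"
  show ?thesis
  proof
    show "r > 0" "(K1 + 1) * (K2 + 1) > 0" using r1 r2 K1 K2 by (auto simp: r_def)
    fix y assume y: "y \<in> M" "y \<in> ball xs r"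
    have yU: "y \<in> U" using y(2) r2(2) by (auto simp: r_def)
    define \<sigma> where "\<sigma> = \<phi> xs - \<phi> y"
    have "norm (\<phi> y - \<phi> xs) \<le> norm (\<phi> y - \<phi> xs - d\<phi> xs (y - xs)) + norm (d\<phi> xs (y - xs))"
      using norm_triangle_sub[of "\<phi> y - \<phi> xs" "d\<phi> xs (y - xs)"] by simp
    also have "\<dots> \<le> (K2 + 1) * norm (y - xs)"
      using r2(3)[of xs y] y(2) r2(1) K2(2)[of "y - xs"] by (simp add: r_def algebra_simps)
    finally have \<sigma>: "norm \<sigma> \<le> (K2 + 1) * norm (y - xs)" by (simp add: \<sigma>_def norm_minus_commute)
    also have "(K2 + 1) * norm (y - xs) < r1"
      using y(2) K2(1) by (simp add: r_def dist_norm norm_minus_commute field_simps)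
    finally have y_ball: "\<phi> y \<in> ball (\<phi> xs) r1" by (simp add: \<sigma>_def dist_norm)
    have seg: "\<phi> y + t *\<^sub>R \<sigma> \<in> ball (\<phi> xs) r1" if "t \<in> {0..1}" for t
    proof -
      have "\<phi> y + t *\<^sub>R \<sigma> = (1 - t) *\<^sub>R \<phi> y + t *\<^sub>R \<phi> xs" by (simp add: \<sigma>_def algebra_simps)
      then show ?thesis using convexD[OF convex_ball y_ball, of "\<phi> xs" "1 - t" t] r1(1) that by simp
    qed
    have V: "\<phi> y + t *\<^sub>R \<sigma> \<in> V" if "t \<in> {0..1}" for t using seg[OF that] r1(2) by blast
    have \<sigma>S: "\<sigma> \<in> S" using phi_in_S xs y(1) yU subspace_S by (simp add: \<sigma>_def subspace_diff)
    have "\<psi> (\<phi> y + t *\<^sub>R \<sigma>) \<in> M" if "t \<in> {0..1}" for t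
      using psi_in_M[OF V[OF that]] phi_in_S[OF yU y(1)] \<sigma>S subspace_S
      by (simp add: subspace_add subspace_scale)
    then have M: "(\<lambda>t. \<psi> (\<phi> y + t *\<^sub>R \<sigma>)) ` {0..1} \<subseteq> M" by blast
    have D: "norm (vector_derivative (\<lambda>t. \<psi> (\<phi> y + t *\<^sub>R \<sigma>)) (at t within {0..1})) \<le> (K1 + 1) * norm \<sigma>"
      if t: "t \<in> {0..1}" for t
    proof -
      have "((\<lambda>t. \<psi> (\<phi> y + t *\<^sub>R \<sigma>)) has_derivative (\<lambda>\<tau>. d\<psi> (\<phi> y + t *\<^sub>R \<sigma>) (\<tau> *\<^sub>R \<sigma>))) (at t)"
        by (rule has_derivative_compose[where f = "\<lambda>t. \<phi> y + t *\<^sub>R \<sigma>"])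
           (use V[OF t] psi_deriv in \<open>auto intro!: derivative_eq_intros\<close>)
      then have "((\<lambda>t. \<psi> (\<phi> y + t *\<^sub>R \<sigma>)) has_vector_derivative d\<psi> (\<phi> y + t *\<^sub>R \<sigma>) \<sigma>) (at t)"
        by (simp add: has_vector_derivative_def linear_cmul[OF linear_dpsi[OF V[OF t]]])
      then have "vector_derivative (\<lambda>t. \<psi> (\<phi> y + t *\<^sub>R \<sigma>)) (at t within {0..1}) = d\<psi> (\<phi> y + t *\<^sub>R \<sigma>) \<sigma>"
        by (rule vector_derivative_within_closed_interval[OF zero_less_one t has_vector_derivative_at_within])
      moreover have "norm (d\<psi> (\<phi> y + t *\<^sub>R \<sigma>) \<sigma>) \<le> norm (d\<psi> (\<phi> y + t *\<^sub>R \<sigma>) \<sigma> - d\<psi> (\<phi> xs) \<sigma>) + norm (d\<psi> (\<phi> xs) \<sigma>)"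
        using norm_triangle_sub[of "d\<psi> (\<phi> y + t *\<^sub>R \<sigma>) \<sigma>" "d\<psi> (\<phi> xs) \<sigma>"] by simp
      ultimately show ?thesis
        using r1(3)[OF seg[OF t], of \<sigma>] K1(2)[of \<sigma>] by (simp add: algebra_simps)
    qed
    have "smooth_on {0..1} (\<lambda>t. \<psi> (\<phi> y + t *\<^sub>R \<sigma>))"
      by (rule smooth_on_affine[OF smooth_psi V])
    from riem_dist_bounds[OF this M _ _ D]
    have "norm (xs - y) \<le> riem_dist M y xs \<and> riem_dist M y xs \<le> (K1 + 1) * norm \<sigma>"
      using xs yU by (simp add: \<sigma>_def)
    moreover have "(K1 + 1) * norm \<sigma> \<le> (K1 + 1) * (K2 + 1) * norm (y - xs)"
      using mult_left_mono[OF \<sigma>, of "K1 + 1"] K1(1) by (simp add: mult.assoc)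
    ultimately show "norm (y - xs) \<le> riem_dist M y xs \<and> riem_dist M y xs \<le> (K1 + 1) * (K2 + 1) * norm (y - xs)"
      by (simp add: norm_minus_commute)
  qed
qed

text \<open>Strict differentiability of a local extension of \<open>R\<close> at
  \<open>(xs, 0)\<close> gives \<open>x + B v\<close> as a uniform approximation, with
  \<open>B\<close> independent of \<open>x\<close>. Comparison with the fibrewise derivative at 0,
  the identity, shows that \<open>B\<close> is close to the identity on each nearby tangent
  space.\<close>

lemma retraction_uniform_first_order:
  assumes xs: "xs \<in> U" "xs \<in> M" and R: "manifold_retraction M R" and "e > 0"
  obtains r where "r > 0" "\<And>x v. x \<in> M \<Longrightarrow> x \<in> ball xs r \<Longrightarrow> v \<in> tangent_space M x \<Longrightarrow> norm v < r \<Longrightarrow>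
      norm (R x v - x - v) \<le> e * norm v"
proof -
  have 0: "0 \<in> tangent_space M x" if "x \<in> U" "x \<in> M" for x
    using subspace_tangent_space[OF that] subspace_0 by blast
  have "(xs, 0) \<in> tangent_bundle M" using 0 xs by (simp add: tangent_bundle_def)
  then obtain W g where W: "open W" "(xs, 0) \<in> W" "\<And>k. Ck_on k W g"
      "\<And>y. y \<in> W \<inter> tangent_bundle M \<Longrightarrow> g y = (case y of (x, v) \<Rightarrow> R x v)"
    using R unfolding manifold_retraction_def smooth_on_def by meson
  \<comment> \<open>One share pays for the approximation by \<open>B\<close>, two for the difference
    between \<open>B\<close> and the identity.\<close>
  define e' where "e' = e / 3"
  have e': "e' > 0" using \<open>e > 0\<close> by (simp add: e'_def)
  define B where "B = (\<lambda>v. frechet_derivative g (at (xs, 0)) (0, v))"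
  have lin: "linear (frechet_derivative g (at (xs, 0)))"
    using Ck_on_has_derivative[OF W(3,2)] has_derivative_linear by blast
  obtain r1 where r1: "r1 > 0" "ball (xs, 0) r1 \<subseteq> W" "\<And>p q. p \<in> ball (xs, 0) r1 \<Longrightarrow> q \<in> ball (xs, 0) r1 \<Longrightarrow>
      norm (g q - g p - frechet_derivative g (at (xs, 0)) (q - p)) \<le> e' * norm (q - p)"
    using C1_strictly_differentiable[OF W(1) W(3) W(2) e'] by blast
  obtain r2 where r2: "r2 > 0" "ball xs r2 \<subseteq> U" using openE[OF open_U xs(1)] by blast
  define r where "r = min r2 (r1 / 2)"
  show ?thesis
  proof
    show "r > 0" using r1 r2 by (simp add: r_def)
    fix x v assume x: "x \<in> M" "x \<in> ball xs r" and v: "v \<in> tangent_space M x" "norm v < r"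
    have xU: "x \<in> U" using x(2) r2(2) by (auto simp: r_def)
    have in_ball: "(x, w) \<in> ball (xs, 0) r1" if "norm w < r" for w
    proof -
      have "dist (xs, 0) (x, w) \<le> dist xs x + norm w"
        unfolding dist_Pair_Pair using sqrt_sum_squares_le_sum[of "dist xs x" "dist 0 w"] by (simp add: dist_norm)
      then show ?thesis using x(2) that by (simp add: r_def)
    qed
    have g_eq: "g (x, w) = R x w" if "norm w < r" "w \<in> tangent_space M x" for w
      using W(4)[of "(x, w)"] in_ball[OF that(1)] r1(2) that(2) x(1) by (auto simp: tangent_bundle_def)
    have Rx0: "R x 0 = x" using R x(1) by (simp add: manifold_retraction_def)
    have est: "norm (R x w - x - B w) \<le> e' * norm w" if w: "norm w < r" "w \<in> tangent_space M x" for w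
      using r1(3)[OF in_ball[of 0] in_ball[OF w(1)]] g_eq[OF w] g_eq[of 0] 0[OF xU x(1)] Rx0 \<open>r > 0\<close>
      by (simp add: B_def norm_Pair)
    have vB: "norm (v - B v) \<le> 2 * e' * norm v"
    proof (cases "v = 0")
      case True
      then show ?thesis using linear_0[OF lin] by (simp add: B_def zero_prod_def)
    next
      case False
      have "(R x has_derivative (\<lambda>v. v)) (at 0 within tangent_space M x)"
        using R x(1) by (simp add: manifold_retraction_def)
      then obtain d where d: "d > 0" "\<And>w. w \<in> tangent_space M x \<Longrightarrow> norm w < d \<Longrightarrow>
          norm (R x w - x - w) \<le> e' * norm w"
        unfolding has_derivative_within_alt using e' Rx0 by (metis diff_zero)
      \<comment> \<open>The radius \<open>d\<close> depends on \<open>x\<close>, so both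
        approximations are compared at a small multiple of \<open>v\<close>; linearity of
        \<open>B\<close> scales the result back.\<close>
      define t where "t = min 1 (d / (2 * norm v))"
      have t: "t > 0" "t \<le> 1" using False d(1) by (auto simp: t_def)
      have "t * norm v \<le> d / (2 * norm v) * norm v" by (intro mult_right_mono) (auto simp: t_def)
      also have "\<dots> < d" using False d(1) by simp
      finally have td: "norm (t *\<^sub>R v) < d" using t by simp
      have tr: "norm (t *\<^sub>R v) < r" using t v(2) mult_left_le_one_le[of "norm v" t] by simp
      have tT: "t *\<^sub>R v \<in> tangent_space M x"
        using subspace_tangent_space[OF xU x(1)] v(1) by (simp add: subspace_scale)
      have "B (t *\<^sub>R v) = t *\<^sub>R B v"
        using linear_cmul[OF lin, of t "(0, v)"] by (simp add: B_def scaleR_Pair)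
      then have "t * norm (v - B v) = norm ((R x (t *\<^sub>R v) - x - B (t *\<^sub>R v)) - (R x (t *\<^sub>R v) - x - t *\<^sub>R v))"
        using t(1) by (simp add: scaleR_diff_right[symmetric])
      also have "\<dots> \<le> e' * norm (t *\<^sub>R v) + e' * norm (t *\<^sub>R v)"
        by (rule order_trans[OF norm_triangle_ineq4 add_mono[OF est[OF tr tT] d(2)[OF tT td]]])
      also have "\<dots> = t * (2 * e' * norm v)" using t(1) by simp
      finally show ?thesis using t(1) by simp
    qed
    have "norm (R x v - x - v) \<le> norm (R x v - x - B v) + norm (v - B v)"
      using norm_triangle_ineq4[of "R x v - x - B v" "v - B v"] by simp
    also have "\<dots> \<le> e' * norm v + 2 * e' * norm v" using est[OF v(2,1)] vB by simp
    finally show "norm (R x v - x - v) \<le> e * norm v" by (simp add: e'_def)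
  qed
qed

end

subsection \<open>Second-order expansion and the Armijo condition\<close>

text \<open>The constant is the minimum of the form on the compact unit sphere of \<open>T\<close>,
  which is empty when \<open>T\<close> is trivial.\<close>

lemma positive_definite_coercive:
  fixes H :: "'a::euclidean_space \<Rightarrow> 'a"
  assumes "subspace T" "linear H" and pos: "\<And>v. v \<in> T \<Longrightarrow> v \<noteq> 0 \<Longrightarrow> H v \<bullet> v > 0"
  obtains a where "a > 0" "\<And>v. v \<in> T \<Longrightarrow> a * (norm v)\<^sup>2 \<le> H v \<bullet> v"
proof (cases "T \<subseteq> {0}")
  case True
  then have "1 * (norm v)\<^sup>2 \<le> H v \<bullet> v" if "v \<in> T" for v using that by auto
  with that[of 1] show ?thesis by simp
next
  case False
  then obtain z where z: "z \<in> T" "z \<noteq> 0" by blast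
  let ?C = "T \<inter> sphere 0 1"
  have "z /\<^sub>R norm z \<in> ?C" using z assms(1) by (simp add: subspace_scale)
  then have "?C \<noteq> {}" by blast
  moreover have "compact ?C" using assms(1) by (simp add: closed_subspace closed_Int_compact)
  moreover have "continuous_on ?C (\<lambda>v. H v \<bullet> v)"
    using assms(2) by (intro continuous_intros linear_continuous_on) (simp add: linear_linear)
  ultimately obtain w where w: "w \<in> ?C" "\<And>v. v \<in> ?C \<Longrightarrow> H w \<bullet> w \<le> H v \<bullet> v"
    using continuous_attains_inf[of ?C "\<lambda>v. H v \<bullet> v"] by blast
  show ?thesis
  proof
    show "H w \<bullet> w > 0" using w(1) by (intro pos) auto
    fix v assume v: "v \<in> T"
    show "(H w \<bullet> w) * (norm v)\<^sup>2 \<le> H v \<bullet> v"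
    proof (cases "v = 0")
      case True
      then show ?thesis by simp
    next
      case False
      define n where "n = norm v"
      have n: "n > 0" using False by (simp add: n_def)
      define q where "q = v /\<^sub>R n"
      have q: "q \<in> ?C" "v = n *\<^sub>R q"
        using v n assms(1) by (auto simp: q_def subspace_scale n_def)
      have "H v \<bullet> v = n\<^sup>2 * (H q \<bullet> q)"
        by (simp add: q(2) linear_cmul[OF assms(2)] power2_eq_square)
      then show ?thesis using w(2)[OF q(1)] by (simp add: n_def[symmetric] mult.commute mult_right_mono)
    qed
  qed
qed

text \<open>Here \<open>u\<close> and \<open>p\<close> are the displacements of \<open>x\<close> and \<open>R x \<eta>\<close> from the minimizer, \<open>v\<close> and \<open>w\<close>
  their tangential approximations, \<open>g\<close> is the gradient at \<open>x\<close>, and \<open>f0\<close>, \<open>f1\<close> are the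
  increments of the objective function from the minimizer to \<open>x\<close> and to \<open>R x \<eta>\<close>.\<close>

lemma armijo_estimate:
  fixes H :: "'a::real_inner \<Rightarrow> 'a"
  assumes H: "linear H" "\<And>z. norm (H z) \<le> K * norm z" and K: "K \<ge> 0"
    and e: "0 < e" "e \<le> 1/5" "e * (4 * (9 * K + 3)) \<le> (1/2 - m) * a"
    and m: "0 < m" "m < 1/2" and a: "a * (norm v)\<^sup>2 \<le> H v \<bullet> v" "a > 0"
    and v: "norm (u - v) \<le> e * norm u" and f0: "\<bar>f0 - H v \<bullet> v / 2\<bar> \<le> e * (norm u)\<^sup>2"
    and p: "norm p \<le> e * norm u" "norm (p - w) \<le> e * norm p"
    and f1: "\<bar>f1 - H w \<bullet> w / 2\<bar> \<le> e * (norm p)\<^sup>2"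
    and g: "norm (g - H u) \<le> e * norm u" and \<eta>: "norm (\<eta> + u) \<le> 5 * e * norm u"
  shows "f1 \<le> f0 + m * (g \<bullet> \<eta>)"
proof -
  define N where "N = norm u"
  have N: "N \<ge> 0" by (simp add: N_def)
  have eN: "0 \<le> e * N" "e * N \<le> N" "5 * e * N \<le> N"
    using e N mult_right_mono[of e 1 N] mult_right_mono[of "5 * e" 1 N] by auto
  have nv: "norm v \<le> 2 * N" "N \<le> 2 * norm v"
  proof -
    have "norm v \<le> norm u + norm (u - v)" "norm u \<le> norm v + norm (u - v)"
      using norm_triangle_sub[of v u] norm_triangle_sub[of u v] by (auto simp: norm_minus_commute)
    moreover have "e * N \<le> N / 2" using e(2) N mult_right_mono[of e "1/2" N] by simp
    ultimately show "norm v \<le> 2 * N" "N \<le> 2 * norm v" using v by (auto simp: N_def)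
  qed
  have np: "norm p \<le> N" using p(1) eN by (simp add: N_def)
  have "e * norm p \<le> norm p" using mult_right_mono[of e 1 "norm p"] e by simp
  then have nw: "norm w \<le> 2 * (e * N)"
    using norm_triangle_sub[of w p] p by (simp add: norm_minus_commute N_def)
  have "H w \<bullet> w \<le> norm (H w) * norm w" by (rule norm_cauchy_schwarz)
  also have "\<dots> \<le> (K * norm w) * norm w" by (intro mult_right_mono H(2)) simp
  also have "\<dots> \<le> (K * (2 * (e * N))) * (2 * (e * N))"
    using nw K eN by (intro mult_mono) auto
  also have "\<dots> = 4 * K * N\<^sup>2 * e * e" by (simp add: power2_eq_square)
  also have "\<dots> \<le> 4 * K * N\<^sup>2 * e * 1" using K e by (intro mult_left_mono) auto
  finally have Hw: "H w \<bullet> w \<le> 4 * K * e * N\<^sup>2" by (simp add: mult_ac)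
  have "e * (norm p)\<^sup>2 \<le> e * N\<^sup>2" using np e by (intro mult_left_mono power_mono) auto
  \<comment> \<open>Half of \<open>4 * K\<close> from the quadratic form, plus 1 from the expansion
    error.\<close>
  then have f1': "f1 \<le> (2 * K + 1) * e * N\<^sup>2" using f1 Hw by (simp add: algebra_simps abs_le_iff)
  have \<eta>N: "norm \<eta> \<le> 2 * N"
    using norm_triangle_ineq4[of "\<eta> + u" u] \<eta> eN by (simp add: N_def)
  have gH: "norm (g - H v) \<le> (K + 1) * (e * N)"
  proof -
    have "g - H v = (g - H u) + H (u - v)" by (simp add: linear_diff[OF H(1)])
    then have "norm (g - H v) \<le> norm (g - H u) + norm (H (u - v))" by (metis norm_triangle_ineq)
    moreover have "K * norm (u - v) \<le> K * (e * N)" using v K by (simp add: N_def mult_left_mono)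
    ultimately show ?thesis using g H(2)[of "u - v"] by (simp add: N_def algebra_simps)
  qed
  have \<eta>v: "norm (\<eta> + v) \<le> 6 * (e * N)"
    using norm_triangle_ineq4[of "\<eta> + u" "u - v"] \<eta> v by (simp add: N_def)
  \<comment> \<open>The two terms contribute \<open>2 * (K + 1)\<close> and \<open>12 * K\<close>,
    which gives \<open>14 * K + 2\<close>.\<close>
  have "g \<bullet> \<eta> + H v \<bullet> v = (g - H v) \<bullet> \<eta> + H v \<bullet> (\<eta> + v)"
    by (simp add: inner_add_right inner_diff_left)
  moreover have "\<bar>(g - H v) \<bullet> \<eta>\<bar> \<le> ((K + 1) * (e * N)) * (2 * N)"
    by (rule order_trans[OF Cauchy_Schwarz_ineq2], rule mult_mono) (use gH \<eta>N K eN in auto)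
  moreover have "\<bar>H v \<bullet> (\<eta> + v)\<bar> \<le> (K * (2 * N)) * (6 * (e * N))"
  proof -
    have "norm (H v) \<le> K * (2 * N)"
      using H(2)[of v] mult_left_mono[OF nv(1) K] by simp
    then show ?thesis
      by (intro order_trans[OF Cauchy_Schwarz_ineq2] mult_mono \<eta>v) (use K N in auto)
  qed
  ultimately have g\<eta>: "g \<bullet> \<eta> \<ge> - (H v \<bullet> v) - (14 * K + 2) * e * N\<^sup>2"
    by (simp add: algebra_simps power2_eq_square abs_le_iff)
  have "(14 * K + 2) * e * N\<^sup>2 \<ge> 0" using K e by simp
  then have "m * ((14 * K + 2) * e * N\<^sup>2) \<le> (7 * K + 1) * e * N\<^sup>2"
    using mult_right_mono[of m "1/2" "(14 * K + 2) * e * N\<^sup>2"] m by (simp add: algebra_simps)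
  then have mg: "m * (g \<bullet> \<eta>) \<ge> - m * (H v \<bullet> v) - (7 * K + 1) * e * N\<^sup>2"
    using mult_left_mono[OF g\<eta>, of m] m by (simp add: algebra_simps)
  \<comment> \<open>Coercivity is in terms of \<open>v\<close>; passing to \<open>N\<close> costs
    the factor 4 seen in the bound on \<open>e\<close>.\<close>
  have "N\<^sup>2 \<le> (2 * norm v)\<^sup>2" using nv(2) N by (intro power_mono)
  then have "N\<^sup>2 / 4 \<le> (norm v)\<^sup>2" by (simp add: power_mult_distrib)
  from order_trans[OF mult_left_mono[OF this less_imp_le[OF a(2)]] a(1)]
  have "a * (N\<^sup>2 / 4) \<le> H v \<bullet> v" .
  then have "(1/2 - m) * (a * (N\<^sup>2 / 4)) \<le> (1/2 - m) * (H v \<bullet> v)" using m by (intro mult_left_mono) auto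
  moreover have "e * (4 * (9 * K + 3)) * (N\<^sup>2 / 4) \<le> (1/2 - m) * a * (N\<^sup>2 / 4)"
    by (intro mult_right_mono e(3)) simp
  ultimately have "e * (4 * (9 * K + 3)) * (N\<^sup>2 / 4) \<le> (1/2 - m) * (H v \<bullet> v)"
    by (simp only: mult.assoc)
  then have "e * (9 * K + 3) * N\<^sup>2 \<le> (1/2 - m) * (H v \<bullet> v)" by (simp add: algebra_simps)
  moreover have "f0 \<ge> H v \<bullet> v / 2 - e * N\<^sup>2" using f0 by (simp add: N_def abs_le_iff)
  \<comment> \<open>The errors \<open>2 * K + 1\<close> from \<open>f1\<close>,
    \<open>7 * K + 1\<close> from the slope and 1 from \<open>f0\<close> add up to
    \<open>9 * K + 3\<close>.\<close>
  ultimately show ?thesis using f1' mg by (simp add: algebra_simps)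
qed

context slice_chart
begin

text \<open>Along the chart line to \<open>x\<close> the derivative of \<open>F\<close> is
  \<open>h\<close> paired with the velocity. As \<open>h\<close> vanishes at \<open>xs\<close>, it
  equals \<open>t * (H v \<bullet> v)\<close> up to a small multiple of
  \<open>(norm \<sigma>)\<^sup>2\<close>; bending of the line affects only this error.\<close>

lemma second_order_expansion:
  assumes xs: "xs \<in> U" "xs \<in> M" and W: "open W" "xs \<in> W"
    and H: "(h has_derivative H) (at xs within M)" "h xs = 0"
    and F: "\<And>x \<gamma>. x \<in> U \<Longrightarrow> x \<in> W \<Longrightarrow> x \<in> M \<Longrightarrow> curve_through M x \<gamma> \<Longrightarrow>
      ((\<lambda>t. F (\<gamma> t)) has_real_derivative h x \<bullet> vector_derivative \<gamma> (at 0)) (at 0)"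
    and "\<epsilon> > 0"
  obtains r where "r > 0" "\<And>x. x \<in> M \<Longrightarrow> x \<in> ball xs r \<Longrightarrow> \<exists>v\<in>tangent_space M xs.
      norm (x - xs - v) \<le> \<epsilon> * norm (x - xs) \<and> \<bar>F x - F xs - H v \<bullet> v / 2\<bar> \<le> \<epsilon> * (norm (x - xs))\<^sup>2"
proof -
  let ?A = "d\<psi> (\<phi> xs)"
  note s0 = phi_in[OF xs(1)]
  obtain K1 where K1: "K1 > 0" "\<And>w. norm (?A w) \<le> norm w * K1"
    using bounded_linear.pos_bounded[OF has_derivative_bounded_linear[OF psi_deriv[OF s0]]] by blast
  obtain K2' where K2': "K2' > 0" "\<And>w. norm (d\<phi> xs w) \<le> norm w * K2'"
    using bounded_linear.pos_bounded[OF has_derivative_bounded_linear[OF phi_deriv[OF xs(1)]]] by blast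
  define K2 where "K2 = K2' + 1"
  obtain KH where KH: "KH > 0" "\<And>w. norm (H w) \<le> norm w * KH"
    using bounded_linear.pos_bounded[OF has_derivative_bounded_linear[OF H(1)]] by blast
  \<comment> \<open>The first summand bounds the effect of replacing the velocity \<open>D\<close>
    by \<open>v\<close>, the second that of replacing the gradient by
    \<open>t *\<^sub>R H v\<close>.\<close>
  define C where "C = KH * K1 + (K1 + 1 + KH) * (K1 + 1)"
  have C: "C > 0" using K1(1) KH(1) by (simp add: C_def add_pos_pos)
  have K2: "K2 > 0" using K2' by (simp add: K2_def)
  \<comment> \<open>Since \<open>norm \<sigma> \<le> K2 * norm u\<close>, the final errors are
    \<open>e * K2\<close> for \<open>v\<close> and \<open>e * (C * K2\<^sup>2)\<close> for
    \<open>F\<close>; the denominator dominates both factors.\<close>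
  define e where "e = min 1 (\<epsilon> / (C * K2\<^sup>2 + K2))"
  have den: "C * K2\<^sup>2 + K2 > 0" using C K2 by (simp add: add_pos_pos)
  have e: "e > 0" "e \<le> 1" using den \<open>\<epsilon> > 0\<close> by (auto simp: e_def)
  have "e * (C * K2\<^sup>2 + K2) \<le> \<epsilon>"
    using pos_le_divide_eq[OF den, of e \<epsilon>] by (simp add: e_def)
  moreover have "e * (C * K2\<^sup>2) \<ge> 0" "e * K2 \<ge> 0" using e C K2 by auto
  ultimately have eK: "e * K2 \<le> \<epsilon>" "e * (C * K2\<^sup>2) \<le> \<epsilon>" by (simp_all add: distrib_left)

  obtain r1 where r1: "r1 > 0" "ball (\<phi> xs) r1 \<subseteq> V" "\<And>s w. s \<in> ball (\<phi> xs) r1 \<Longrightarrow>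
      norm (d\<psi> s w - ?A w) \<le> e * norm w"
    using C1_derivative_continuous[OF open_V smooth_on_open[OF open_V smooth_psi] s0 e(1)] by blast
  obtain r2 where r2: "r2 > 0" "ball (\<phi> xs) r2 \<subseteq> V" "\<And>s s'. s \<in> ball (\<phi> xs) r2 \<Longrightarrow> s' \<in> ball (\<phi> xs) r2 \<Longrightarrow>
      norm (\<psi> s' - \<psi> s - ?A (s' - s)) \<le> e * norm (s' - s)"
    using C1_strictly_differentiable[OF open_V smooth_on_open[OF open_V smooth_psi] s0 e(1)] by blast
  obtain r3 where r3: "r3 > 0" "ball xs r3 \<subseteq> U" "\<And>x y. x \<in> ball xs r3 \<Longrightarrow> y \<in> ball xs r3 \<Longrightarrow>
      norm (\<phi> y - \<phi> x - d\<phi> xs (y - x)) \<le> 1 * norm (y - x)"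
    using C1_strictly_differentiable[OF open_U smooth_on_open[OF open_U smooth_phi] xs(1), of 1] by auto
  obtain r4 where r4: "r4 > 0" "\<And>y. y \<in> M \<Longrightarrow> norm (y - xs) < r4 \<Longrightarrow>
      norm (h y - h xs - H (y - xs)) \<le> e * norm (y - xs)"
    using H(1) e(1) unfolding has_derivative_within_alt by blast
  have "open (ball xs r4 \<inter> W)" using W(1) by blast
  moreover have "isCont \<psi> (\<phi> xs)" using psi_deriv[OF s0] has_derivative_continuous by blast
  moreover have "\<psi> (\<phi> xs) \<in> ball xs r4 \<inter> W" using xs(1) r4(1) W(2) by simp
  ultimately have "\<forall>\<^sub>F s in nhds (\<phi> xs). \<psi> s \<in> ball xs r4 \<inter> W"
    unfolding isCont_def tendsto_at_iff_tendsto_nhds by (blast dest: topological_tendstoD)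
  then obtain r5 where r5: "r5 > 0" "\<And>s. dist s (\<phi> xs) < r5 \<Longrightarrow> \<psi> s \<in> ball xs r4 \<inter> W"
    unfolding eventually_nhds_metric by blast
  define r' where "r' = min r1 (min r2 r5)"
  define r where "r = min r3 (r' / K2)"
  have r': "r' > 0" using r1 r2 r5 by (simp add: r'_def)
  show ?thesis
  proof
    show "r > 0" using r' r3 K2 by (simp add: r_def)
    fix x assume x: "x \<in> M" "x \<in> ball xs r"
    have xU: "x \<in> U" using x(2) r3(2) by (auto simp: r_def)
    define u where "u = x - xs"
    define \<sigma> where "\<sigma> = \<phi> x - \<phi> xs"
    define v where "v = ?A \<sigma>"
    have "norm \<sigma> \<le> norm (d\<phi> xs u) + norm (\<sigma> - d\<phi> xs u)" by (rule norm_triangle_sub)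
    also have "\<dots> \<le> K2 * norm u"
      using r3(3)[of xs x] x(2) r3(1) K2'(2)[of u] by (simp add: r_def algebra_simps K2_def u_def \<sigma>_def)
    finally have \<sigma>: "norm \<sigma> \<le> K2 * norm u" .
    also have "K2 * norm u < r'"
      using x(2) K2 by (simp add: r_def dist_norm norm_minus_commute field_simps u_def)
    finally have \<sigma>r: "norm \<sigma> < r'" .
    have \<sigma>S: "\<sigma> \<in> S" using phi_in_S xs x(1) xU subspace_S by (simp add: \<sigma>_def subspace_diff)
    have vT: "v \<in> tangent_space M xs"
      using \<sigma>S by (simp add: tangent_space_iff[OF xs] v_def dphi_dpsi[OF xs(1)])
    have A_cmul: "?A (t *\<^sub>R \<sigma>) = t *\<^sub>R v" for t by (simp add: linear_cmul[OF linear_dpsi[OF s0]] v_def)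
    define s where "s = (\<lambda>t. \<phi> xs + t *\<^sub>R \<sigma>)"
    have s_ball: "norm (s t - \<phi> xs) < r'" if "0 \<le> t" "t \<le> 1" for t
      using \<sigma>r that mult_left_le_one_le[of "norm \<sigma>" t] by (simp add: s_def)
    have sV: "s t \<in> V" if "0 \<le> t" "t \<le> 1" for t
      using s_ball[OF that] r1(2) by (auto simp: r'_def dist_norm norm_minus_commute subset_iff)
    have sM: "\<psi> (s t) \<in> M" if "0 \<le> t" "t \<le> 1" for t
      using psi_in_M[OF sV[OF that]] phi_in_S[OF xs] \<sigma>S subspace_S
      by (simp add: s_def subspace_add subspace_scale)
    have approx: "norm (\<psi> (s t) - xs - t *\<^sub>R v) \<le> e * (t * norm \<sigma>)" if "0 \<le> t" "t \<le> 1" for t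
      using r2(3)[of "\<phi> xs" "s t"] s_ball[OF that] r2(1) that xs(1)
      by (simp add: r'_def dist_norm norm_minus_commute s_def A_cmul)
    have nv: "norm v \<le> K1 * norm \<sigma>" using K1(2)[of \<sigma>] by (simp add: v_def mult.commute)
    have deriv: "\<exists>D. ((\<lambda>t. F (\<psi> (s t))) has_real_derivative D) (at t) \<and>
        \<bar>D - t * (H v \<bullet> v)\<bar> \<le> e * C * (norm \<sigma>)\<^sup>2" if t: "0 \<le> t" "t \<le> 1" for t
    proof -
      define y where "y = \<psi> (s t)"
      define D where "D = d\<psi> (s t) \<sigma>"
      have y: "y \<in> U" "y \<in> M" "y \<in> W" "norm (y - xs) < r4" "\<phi> y = s t"
        using sV[OF t] sM[OF t] r5(2)[of "s t"] s_ball[OF t]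
        by (auto simp: y_def r'_def dist_norm norm_minus_commute)
      have "((\<lambda>\<tau>. F (\<psi> (\<phi> y + \<tau> *\<^sub>R \<sigma>))) has_real_derivative h y \<bullet> D) (at 0)"
        using F[OF y(1,3,2) coordinate_line(1)[OF y(1,2) \<sigma>S]]
        unfolding coordinate_line(2)[OF y(1,2) \<sigma>S] unfolding y(5) D_def .
      \<comment> \<open>The coordinate line through \<open>y\<close> is the same chart line with
        time shifted by \<open>t\<close>.\<close>
      moreover have "\<phi> y + \<tau> *\<^sub>R \<sigma> = s (\<tau> + t)" for \<tau> by (simp add: y(5) s_def algebra_simps)
      ultimately have "((\<lambda>t. F (\<psi> (s t))) has_real_derivative h y \<bullet> D) (at t)"
        using DERIV_shift[of "\<lambda>t. F (\<psi> (s t))" "h y \<bullet> D" 0 t] by simp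
      moreover have "\<bar>h y \<bullet> D - t * (H v \<bullet> v)\<bar> \<le> e * C * (norm \<sigma>)\<^sup>2"
      proof -
        let ?n = "norm \<sigma>"
        have D1: "norm (D - v) \<le> e * ?n"
          using r1(3)[of "s t" \<sigma>] s_ball[OF t] by (simp add: D_def v_def r'_def dist_norm norm_minus_commute)
        have en: "e * ?n \<le> ?n" using e mult_right_mono[of e 1 ?n] by simp
        have D2: "norm D \<le> (K1 + 1) * ?n"
          using norm_triangle_sub[of D v] D1 nv en by (simp add: algebra_simps)
        have tn: "t * ?n \<le> ?n" using t mult_left_le_one_le[of ?n t] by simp
        have q: "norm (y - xs - t *\<^sub>R v) \<le> e * ?n"
          unfolding y_def by (rule order_trans[OF approx[OF t] mult_left_mono[OF tn less_imp_le[OF e(1)]]])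
        have "t * norm v \<le> norm v" using t mult_left_le_one_le[of "norm v" t] by simp
        then have yx: "norm (y - xs) \<le> (K1 + 1) * ?n"
          using norm_triangle_sub[of "y - xs" "t *\<^sub>R v"] q en nv t by (simp add: algebra_simps)
        have "h y - t *\<^sub>R H v = (h y - h xs - H (y - xs)) + H (y - xs - t *\<^sub>R v)"
          using has_derivative_linear[OF H(1)] by (simp add: H(2) linear_diff linear_cmul)
        then have "norm (h y - t *\<^sub>R H v) \<le> norm (h y - h xs - H (y - xs)) + norm (H (y - xs - t *\<^sub>R v))"
          by (metis norm_triangle_ineq)
        also have "\<dots> \<le> e * ((K1 + 1) * ?n) + e * ?n * KH"
          by (rule add_mono[OF order_trans[OF r4(2)[OF y(2,4)] mult_left_mono[OF yx less_imp_le[OF e(1)]]]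
                order_trans[OF KH(2) mult_right_mono[OF q less_imp_le[OF KH(1)]]]])
        finally have E: "norm (h y - t *\<^sub>R H v) \<le> e * (K1 + 1 + KH) * ?n" by (simp add: algebra_simps)
        have "h y \<bullet> D - t * (H v \<bullet> v) = t * (H v \<bullet> (D - v)) + (h y - t *\<^sub>R H v) \<bullet> D"
          by (simp add: inner_diff_left inner_diff_right algebra_simps)
        moreover have "\<bar>t * (H v \<bullet> (D - v))\<bar> \<le> KH * (K1 * ?n) * (e * ?n)"
        proof -
          have "norm (H v) \<le> KH * (K1 * ?n)"
            using order_trans[OF KH(2) mult_right_mono[OF nv less_imp_le[OF KH(1)]]] by (simp add: mult_ac)
          then have "\<bar>H v \<bullet> (D - v)\<bar> \<le> KH * (K1 * ?n) * (e * ?n)"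
            by (intro order_trans[OF Cauchy_Schwarz_ineq2] mult_mono D1) (use KH(1) K1(1) in auto)
          moreover have "\<bar>t * (H v \<bullet> (D - v))\<bar> \<le> \<bar>H v \<bullet> (D - v)\<bar>"
            using t mult_left_le_one_le[of "\<bar>H v \<bullet> (D - v)\<bar>" t] by (simp add: abs_mult)
          ultimately show ?thesis by simp
        qed
        moreover have "\<bar>(h y - t *\<^sub>R H v) \<bullet> D\<bar> \<le> (e * (K1 + 1 + KH) * ?n) * ((K1 + 1) * ?n)"
          by (intro order_trans[OF Cauchy_Schwarz_ineq2] mult_mono E D2) (use e K1(1) KH(1) in auto)
        moreover have "KH * (K1 * ?n) * (e * ?n) + (e * (K1 + 1 + KH) * ?n) * ((K1 + 1) * ?n) = e * C * ?n\<^sup>2"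
          by (simp add: C_def power2_eq_square algebra_simps)
        ultimately show ?thesis by linarith
      qed
      ultimately show ?thesis by blast
    qed
    \<comment> \<open>With the quadratic model subtracted, the mean value theorem needs only a bound
      on the derivative, not its continuity.\<close>
    define k where "k = (\<lambda>t. F (\<psi> (s t)) - t\<^sup>2 / 2 * (H v \<bullet> v))"
    have kD: "\<exists>D. (k has_real_derivative D) (at t) \<and> \<bar>D\<bar> \<le> e * C * (norm \<sigma>)\<^sup>2" if t: "0 \<le> t" "t \<le> 1" for t
    proof -
      obtain D where D: "((\<lambda>t. F (\<psi> (s t))) has_real_derivative D) (at t)"
          "\<bar>D - t * (H v \<bullet> v)\<bar> \<le> e * C * (norm \<sigma>)\<^sup>2"
        using deriv[OF t] by blast
      have "(k has_real_derivative D - t * (H v \<bullet> v)) (at t)"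
        unfolding k_def by (rule D(1) derivative_eq_intros | simp)+
      with D(2) show ?thesis by blast
    qed
    then obtain k' where k': "\<And>t. 0 \<le> t \<Longrightarrow> t \<le> 1 \<Longrightarrow> (k has_real_derivative k' t) (at t)"
        "\<And>t. 0 \<le> t \<Longrightarrow> t \<le> 1 \<Longrightarrow> \<bar>k' t\<bar> \<le> e * C * (norm \<sigma>)\<^sup>2" by metis
    obtain z where z: "0 < z" "z < 1" "k 1 - k 0 = (1 - 0) * k' z"
      using MVT2[of 0 1 k k'] k'(1) by auto
    have "\<psi> (s 1) = x" "\<psi> (s 0) = xs" using xs(1) xU by (simp_all add: s_def \<sigma>_def)
    then have "\<bar>F x - F xs - H v \<bullet> v / 2\<bar> \<le> e * C * (norm \<sigma>)\<^sup>2"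
      using z k'(2)[of z] by (simp add: k_def algebra_simps)
    also have "\<dots> \<le> e * C * (K2 * norm u)\<^sup>2"
      using \<sigma> e C by (intro mult_left_mono power_mono) auto
    also have "\<dots> = e * (C * K2\<^sup>2) * (norm u)\<^sup>2" by (simp add: power_mult_distrib)
    also have "\<dots> \<le> \<epsilon> * (norm u)\<^sup>2" using eK by (intro mult_right_mono) auto
    finally have 1: "\<bar>F x - F xs - H v \<bullet> v / 2\<bar> \<le> \<epsilon> * (norm u)\<^sup>2" .
    have "norm (u - v) \<le> e * norm \<sigma>"
      using approx[of 1] xU by (simp add: u_def s_def \<sigma>_def)
    also have "\<dots> \<le> e * (K2 * norm u)" using \<sigma> e by (intro mult_left_mono) auto
    also have "\<dots> = (e * K2) * norm u" by simp
    also have "\<dots> \<le> \<epsilon> * norm u" using eK by (intro mult_right_mono) auto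
    finally show "\<exists>v\<in>tangent_space M xs. norm (x - xs - v) \<le> \<epsilon> * norm (x - xs) \<and>
        \<bar>F x - F xs - H v \<bullet> v / 2\<bar> \<le> \<epsilon> * (norm (x - xs))\<^sup>2"
      using 1 vT by (auto simp: u_def)
  qed
qed

end

text \<open>Along a curve with velocity \<open>g\<close> the derivative of \<open>F\<close> is
  \<open>g \<bullet> g\<close>, and it vanishes at a minimum.\<close>

lemma rgrad_zero_at_local_min:
  assumes T: "g \<in> tangent_space M x"
    and D: "\<And>\<gamma>. curve_through M x \<gamma> \<Longrightarrow>
      ((\<lambda>t. F (\<gamma> t)) has_real_derivative g \<bullet> vector_derivative \<gamma> (at 0)) (at 0)"
    and "e > 0" and min: "\<And>y. y \<in> M \<inter> ball x e \<Longrightarrow> F x \<le> F y"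
  shows "g = (0::'a::euclidean_space)"
proof -
  obtain \<gamma> where \<gamma>: "curve_through M x \<gamma>" "g = vector_derivative \<gamma> (at 0)"
    using T by (auto simp: tangent_space_def)
  have x: "\<gamma> 0 = x" using \<gamma>(1) by (simp add: curve_through_def)
  have "\<forall>\<^sub>F t in nhds 0. \<gamma> t \<in> M \<inter> ball x e"
    using \<open>e > 0\<close> by (intro curve_through_eventually[OF \<gamma>(1)]) auto
  then obtain d where d: "d > 0" "\<And>t. dist t 0 < d \<Longrightarrow> \<gamma> t \<in> M \<inter> ball x e"
    unfolding eventually_nhds_metric by blast
  have "\<forall>t. \<bar>0 - t\<bar> < d \<longrightarrow> F (\<gamma> 0) \<le> F (\<gamma> t)"
    using d(2) min by (simp add: x dist_norm)
  then have "g \<bullet> g = 0" using DERIV_local_min[OF D[OF \<gamma>(1)] d(1)] \<gamma>(2) by simp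
  then show ?thesis by simp
qed

text \<open>The direction is a function of \<open>x\<close>, as the superlinear condition concerns a
  family. The bound \<rho> excludes long vectors: on a circle with its exponential map, a direction
  that winds once more around can reach \<open>xs\<close> exactly, yet its slope term is of first
  order in the distance while the decrease of \<open>F\<close> is of second order.\<close>

theorem theoremB1:
  fixes M :: "'a::euclidean_space set" and d :: nat
    and R :: "'a \<Rightarrow> 'a \<Rightarrow> 'a" and F :: "'a \<Rightarrow> real"
    and xs :: 'a and m1 :: real
  assumes "submanifold d M"
    and "manifold_retraction M R"
    and "twice_differentiable_on_manifold M F"
    and "strong_local_minimizer M F xs"
    and "0 < m1" and "m1 < 1/2"
  shows "\<exists>\<rho>>0. \<forall>\<eta> :: 'a \<Rightarrow> 'a.
    (\<forall>\<^sub>F x in at xs within M. \<eta> x \<in> tangent_space M x \<and> norm (\<eta> x) < \<rho>) \<longrightarrow>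
    (\<lambda>x. riem_dist M (R x (\<eta> x)) xs) \<in> o[at xs within M](\<lambda>x. riem_dist M x xs) \<longrightarrow>
    (\<forall>\<^sub>F x in at xs within M. armijo_acceptable M R F m1 x (\<eta> x) 1)"
proof -
  have xsM: "xs \<in> M" using assms(4) by (simp add: strong_local_minimizer_def)
  obtain U V \<phi> \<psi> S where "open U" and xsU: "xs \<in> U" and "open (V :: 'a set)" "homeomorphism U V \<phi> \<psi>"
     "smooth_on U \<phi>" "smooth_on V \<psi>" "subspace S" "\<phi> ` (U \<inter> M) = V \<inter> S"
    using assms(1) xsM unfolding submanifold_def by meson
  then interpret slice_chart M U V S \<phi> \<psi> by unfold_locales
  from bspec[OF assms(3)[unfolded twice_differentiable_on_manifold_def] xsM]
  obtain W G g where W: "open W" "xs \<in> W"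
    and Gg: "\<forall>y\<in>W. (G has_derivative (\<lambda>h. g y \<bullet> h)) (at y) \<and> g differentiable (at y)"
    and GF: "\<forall>y\<in>W \<inter> M. G y = F y"
    by (elim exE conjE) (rule that)
  have G: "(G has_derivative (\<lambda>h. g y \<bullet> h)) (at y)" if "y \<in> W" for y using Gg that by blast
  define h where "h = rgrad M F"
  have "g differentiable (at xs)" using Gg W(2) by blast
  from rgrad_differentiable[OF xsU xsM W G this GF]
  obtain H where H: "(h has_derivative H) (at xs within M)" unfolding h_def differentiable_def by blast
  have lin: "linear H" by (rule has_derivative_linear[OF H])
  let ?T = "tangent_space M xs"
  have grad: "((\<lambda>t. F (\<gamma> t)) has_real_derivative h x \<bullet> vector_derivative \<gamma> (at 0)) (at 0)"
    if "x \<in> U" "x \<in> W" "x \<in> M" "curve_through M x \<gamma>" for x \<gamma>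
    using rgrad_characterization(3)[OF that(1,3) W(1) that(2) G[OF that(2)] GF that(4)] by (simp add: h_def)
  obtain e0 where "e0 > 0" "\<forall>y\<in>M \<inter> ball xs e0. F xs \<le> F y"
    using assms(4) unfolding strong_local_minimizer_def by blast
  then have h0: "h xs = 0"
    using rgrad_zero_at_local_min[of "h xs" M xs F e0] grad[OF xsU W(2) xsM]
      rgrad_characterization(1)[OF xsU xsM W G[OF W(2)] GF] by (simp add: h_def)
  have "H v \<bullet> v > 0" if "v \<in> ?T" "v \<noteq> 0" for v
    using rhess_inner[OF xsU xsM that(1) H[unfolded h_def]] assms(4) that
    unfolding strong_local_minimizer_def by metis
  then obtain a where a: "a > 0" "\<And>v. v \<in> ?T \<Longrightarrow> a * (norm v)\<^sup>2 \<le> H v \<bullet> v"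
    using positive_definite_coercive[OF subspace_tangent_space[OF xsU xsM] lin] by blast
  obtain K where K: "K > 0" "\<And>v. norm (H v) \<le> norm v * K"
    using bounded_linear.pos_bounded[OF has_derivative_bounded_linear[OF H]] by blast
  \<comment> \<open>The crude tolerance 1/2 makes \<open>\<eta> x\<close> and
    \<open>R x (\<eta> x) - x\<close> comparable before \<open>\<eta> x\<close> is known to be of
    the order of \<open>u\<close>; the tolerance \<open>e\<close> comes in afterwards.\<close>
  obtain r0 where r0: "r0 > 0" "\<And>x v. x \<in> M \<Longrightarrow> x \<in> ball xs r0 \<Longrightarrow> v \<in> tangent_space M x \<Longrightarrow>
      norm v < r0 \<Longrightarrow> norm (R x v - x - v) \<le> 1/2 * norm v"
    using retraction_uniform_first_order[OF xsU xsM assms(2), of "1/2"] by auto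
  obtain r1 Kd where r1: "r1 > 0" "Kd > 0" "\<And>y. y \<in> M \<Longrightarrow> y \<in> ball xs r1 \<Longrightarrow>
      norm (y - xs) \<le> riem_dist M y xs \<and> riem_dist M y xs \<le> Kd * norm (y - xs)"
    using riem_dist_equivalent_norm[OF xsU xsM] by blast
  define e where "e = min (1/5) ((1/2 - m1) * a / (4 * (9 * K + 3)))"
  have den: "4 * (9 * K + 3) > 0" using K(1) by simp
  have e: "e > 0" "e \<le> 1/5" "e * (4 * (9 * K + 3)) \<le> (1/2 - m1) * a"
  proof -
    show "e > 0" unfolding e_def using den a(1) assms(6) by simp
    show "e \<le> 1/5" unfolding e_def by (rule min.cobounded1)
    have "e \<le> (1/2 - m1) * a / (4 * (9 * K + 3))" unfolding e_def by (rule min.cobounded2)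
    then show "e * (4 * (9 * K + 3)) \<le> (1/2 - m1) * a" unfolding pos_le_divide_eq[OF den] .
  qed
  obtain r2 where r2: "r2 > 0" "\<And>x v. x \<in> M \<Longrightarrow> x \<in> ball xs r2 \<Longrightarrow> v \<in> tangent_space M x \<Longrightarrow>
      norm v < r2 \<Longrightarrow> norm (R x v - x - v) \<le> e * norm v"
    using retraction_uniform_first_order[OF xsU xsM assms(2) e(1)] by blast
  obtain r3 where r3: "r3 > 0" "\<And>x. x \<in> M \<Longrightarrow> x \<in> ball xs r3 \<Longrightarrow> \<exists>v\<in>?T.
      norm (x - xs - v) \<le> e * norm (x - xs) \<and> \<bar>F x - F xs - H v \<bullet> v / 2\<bar> \<le> e * (norm (x - xs))\<^sup>2"
    using second_order_expansion[OF xsU xsM W H h0 grad e(1)] by blast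
  obtain r4 where r4: "r4 > 0" "\<And>y. y \<in> M \<Longrightarrow> norm (y - xs) < r4 \<Longrightarrow>
      norm (h y - h xs - H (y - xs)) \<le> e * norm (y - xs)"
    using H e(1) unfolding has_derivative_within_alt by blast
  \<comment> \<open>With \<rho> at most \<open>r1 / 3\<close>, the point
    \<open>R x (\<eta> x)\<close> is within \<open>3/2 * (r1 / 3) + r1 / 2 = r1\<close> of
    \<open>xs\<close>; \<open>r2 / 4\<close> anticipates
    \<open>norm (\<eta> x) \<le> 4 * norm u\<close>.\<close>
  define r where "r = min r0 (min (r1 / 2) (min (r2 / 4) (min r3 r4)))"
  have r: "r > 0" "r \<le> r0" "r \<le> r1 / 2" "r \<le> r2 / 4" "r \<le> r3" "r \<le> r4"
    using r0 r1 r2 r3 r4 by (auto simp: r_def)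
  \<comment> \<open>Steps shorter than \<open>\<rho>\<close> keep \<open>R x \<eta>\<close> in the ball where the Riemannian distance dominates the
    Euclidean one; elsewhere it may be the unspecified infimum of the empty set.\<close>
  define \<rho> where "\<rho> = min r0 (r1 / 3)"
  show ?thesis
  proof (intro exI[of _ \<rho>] conjI allI impI)
    show "\<rho> > 0" using r0 r1 by (simp add: \<rho>_def)
    fix \<eta> :: "'a \<Rightarrow> 'a"
    assume \<eta>: "\<forall>\<^sub>F x in at xs within M. \<eta> x \<in> tangent_space M x \<and> norm (\<eta> x) < \<rho>"
      and o: "(\<lambda>x. riem_dist M (R x (\<eta> x)) xs) \<in> o[at xs within M](\<lambda>x. riem_dist M x xs)"
    \<comment> \<open>Dividing by \<open>Kd\<close> cancels the constant lost in passing from the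
      Riemannian to the Euclidean norm.\<close>
    have "e / Kd > 0" using e(1) r1(2) by simp
    from landau_o.smallD[OF o this]
    have "\<forall>\<^sub>F x in at xs within M. norm (riem_dist M (R x (\<eta> x)) xs) \<le> e / Kd * norm (riem_dist M x xs)" .
    moreover have "\<forall>\<^sub>F x in at xs within M. x \<in> M \<and> dist x xs < r"
      using r(1) by (auto simp: eventually_at)
    ultimately show "\<forall>\<^sub>F x in at xs within M. armijo_acceptable M R F m1 x (\<eta> x) 1"
      using \<eta>
    proof eventually_elim
      case (elim x)
      define y where "y = R x (\<eta> x)"
      define u where "u = x - xs"
      define p where "p = y - xs"
      have x: "x \<in> M" "norm u < r" using elim by (auto simp: u_def dist_norm)
      have \<eta>x: "\<eta> x \<in> tangent_space M x" "norm (\<eta> x) < \<rho>" using elim by auto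
      have yM: "y \<in> M" using assms(2) x(1) \<eta>x(1) by (simp add: y_def manifold_retraction_def)
      have x_ball: "x \<in> ball xs s" if "r \<le> s" for s
        using x(2) that by (simp add: u_def dist_norm norm_minus_commute)
      have half: "norm (y - x - \<eta> x) \<le> 1/2 * norm (\<eta> x)"
        using r0(2)[OF x(1) x_ball[OF r(2)] \<eta>x(1)] \<eta>x(2) by (simp add: y_def \<rho>_def)
      have yx: "norm (y - x) \<le> 3/2 * norm (\<eta> x)"
        using norm_triangle_sub[of "y - x" "\<eta> x"] half by simp
      have "norm p \<le> norm (y - x) + norm u"
        using norm_triangle_ineq[of "y - x" u] by (simp add: p_def u_def)
      also have "\<dots> < r1" using yx \<eta>x(2) x(2) r(3) by (simp add: \<rho>_def)
      finally have "y \<in> ball xs r1" by (simp add: p_def dist_norm norm_minus_commute)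
      note ry = r1(3)[OF yM this]
      have rx: "norm u \<le> riem_dist M x xs" "riem_dist M x xs \<le> Kd * norm u"
        using r1(3)[OF x(1) x_ball] r(3) r1(1) by (auto simp: u_def)
      have "norm p \<le> \<bar>riem_dist M y xs\<bar>" using ry unfolding p_def by linarith
      also have "\<dots> \<le> e / Kd * \<bar>riem_dist M x xs\<bar>" using elim(1) by (simp add: y_def)
      also have "\<bar>riem_dist M x xs\<bar> \<le> Kd * norm u" using rx norm_ge_zero[of u] by linarith
      finally have p: "norm p \<le> e * norm u" using e(1) r1(2) by (simp add: divide_right_mono mult_left_mono)
      have eu: "e * norm u \<le> norm u" using e mult_right_mono[of e 1 "norm u"] by simp
      have "norm (\<eta> x) \<le> 2 * norm (y - x)"
        using norm_triangle_sub[of "\<eta> x" "y - x"] half by (simp add: norm_minus_commute)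
      moreover have "norm (y - x) \<le> norm p + norm u"
        using norm_triangle_ineq4[of p u] by (simp add: p_def u_def)
      ultimately have \<eta>u: "norm (\<eta> x) \<le> 4 * norm u" using p eu by simp
      have "norm (y - x - \<eta> x) \<le> e * norm (\<eta> x)"
        using r2(2)[OF x(1) x_ball \<eta>x(1)] \<eta>u x(2) r(4) r2(1) by (simp add: y_def)
      also have "\<dots> \<le> e * (4 * norm u)" using \<eta>u e by (intro mult_left_mono) auto
      \<comment> \<open>\<open>\<eta> x + u\<close> is \<open>p\<close> minus the retraction error;
        these contribute \<open>e\<close> and \<open>4 * e\<close>.\<close>
      finally have "norm (\<eta> x + u) \<le> 5 * e * norm u"
        using norm_triangle_ineq4[of p "y - x - \<eta> x"] p by (simp add: p_def u_def algebra_simps)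
      moreover have "norm (h x - H u) \<le> e * norm u"
        using r4(2)[OF x(1)] x(2) r(6) h0 by (simp add: u_def)
      moreover obtain v where "v \<in> ?T" "norm (u - v) \<le> e * norm u" "\<bar>F x - F xs - H v \<bullet> v / 2\<bar> \<le> e * (norm u)\<^sup>2"
        using r3(2)[OF x(1) x_ball[OF r(5)]] by (auto simp: u_def)
      moreover obtain w where "norm (p - w) \<le> e * norm p" "\<bar>F y - F xs - H w \<bullet> w / 2\<bar> \<le> e * (norm p)\<^sup>2"
        using r3(2)[OF yM] p eu x(2) r(5) by (auto simp: p_def dist_norm norm_minus_commute)
      ultimately have "F y - F xs \<le> (F x - F xs) + m1 * (h x \<bullet> \<eta> x)"
        using armijo_estimate[OF lin _ less_imp_le[OF K(1)] e assms(5,6) a(2) a(1)] K(2) p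
        by (simp add: mult.commute)
      then show ?case by (simp add: armijo_acceptable_def h_def y_def)
    qed
  qed
qed

end
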